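(* Let $\Gamma\subset SL(2,\mathbf{Z})$ be a congruence subgroup, $\alpha\in GL(2,\mathbf{Q})$ with $\det\alpha>0$, and $\Gamma'=\Gamma\cap\alpha^{-1}\Gamma\alpha$. Let $L$ be a subfield of $\mathbf{C}$ such that for all weights $\kappa$ the spaces $\mathcal{M}_\kappa(\Gamma)$ and $\mathcal{M}_\kappa(\Gamma')$ have a basis of forms whose $q$-expansions have coefficients in $L$, and such that if $f\in\mathcal{M}_\kappa(\Gamma)$ has $q$-expansion coefficients in $L$, then so does $f'$. Assume that the generators $a_1,\dots,a_r$ of $\mathcal{R}_\Gamma$ are moreover chosen to all have $q$-expansion coefficients in $L$. Then the generating function $$F_{\Gamma\alpha\Gamma}(A_1,\dots,A_r,a_1,\dots,a_r)=\sum_{m=a_1^{i_1}\cdots a_r^{i_r}\in\mathcal{B}}A_1^{i_1}\cdots A_r^{i_r}\,\bigl[a_1^{i_1}\cdots a_r^{i_r}\mid\Gamma\alpha\Gamma\bigr]\in\mathcal{R}_\Gamma[[A_1,\dots,A_r]]$$ is a rational function in the indeterminates $a_1,\dots,a_r,A_1,\dots,A_r$ with coefficients in $L$; that is, there are polynomials $P,Q$ in these $2r$ indeterminates with coefficients in $L$ such that the image of $Q$ in $\mathcal{R}_\Gamma[A_1,\dots,A_r]$ is nonzero and $Q\cdot F_{\Gamma\alpha\Gamma}=P$ in $\mathcal{R}_\Gamma[[A_1,\dots,A_r]]$.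
   Context: $\mathcal{M}_\kappa(\Gamma)$ is the space of weight $\kappa$ modular forms for $\Gamma$, and $\mathcal{R}_\Gamma=\bigoplus_{\kappa\ge0}\mathcal{M}_\kappa(\Gamma)$, a finitely generated graded $\mathbf{C}$-algebra. Choose generators $a_1,\dots,a_r$ of this algebra with $a_i\in\mathcal{M}_{\kappa_i}(\Gamma)$, let $I$ be the ideal of relations among them, so $\mathcal{R}_\Gamma=\mathbf{C}[a_1,\dots,a_r]/I$, fix a term order on monomials in the $a_i$ with initial ideal $\operatorname{in}(I)$, and let $\mathcal{B}=\{\text{monomials }m\mid m\notin\operatorname{in}(I)\}$, whose image is a $\mathbf{C}$-basis of $\mathcal{R}_\Gamma$. $A_1,\dots,A_r$ are formal variables. For $\alpha=\begin{pmatrix}*&*\\c&d\end{pmatrix}\in GL(2,\mathbf{Q})$ with $\det\alpha>0$, $(f|_\kappa\alpha)(\tau)=f(\alpha\tau)(c\tau+d)^{-\kappa}$. Fix a nonzero normalizing constant $C$; for $f\in\mathcal{M}_\kappa(\Gamma)$ put $f'=C^\kappa f|_\kappa\alpha\in\mathcal{M}_\kappa(\Gamma')$. The Hecke operator of the double coset $\Gamma\alpha\Gamma$ (normalized with $C$ and a further constant factor $c_0\in L$, e.g. $c_0=1$) acts on $f\in\mathcal{M}_\kappa(\Gamma)$ by $[f\mid\Gamma\alpha\Gamma]=c_0\sum_{\gamma\in\Gamma'\backslash\Gamma}f'|_\kappa\gamma$. The $q$-expansion of a form is its Fourier expansion at $i\infty$, possibly in fractional powers of $q=e^{2\pi i\tau}$.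 *)

theory Defs
  imports
    "HOL-Analysis.Analysis"
    "HOL-Library.Poly_Mapping"
    "HOL-Library.Function_Algebras"
begin

text \<open>
  Forms are functions on the type of points of the upper half plane. With the pointwise operations
  of Function_Algebras they form a commutative ring with unit.
\<close>

typedef upper_half_plane = "{z :: complex. Im z > 0}"
  morphisms of_uhp Abs_uhp
  by (rule exI[of _ \<i>]) simp

definition fun_scale :: "complex \<Rightarrow> (upper_half_plane \<Rightarrow> complex) \<Rightarrow> upper_half_plane \<Rightarrow> complex"
  where "fun_scale c f = (\<lambda>\<tau>. c * f \<tau>)"

global_interpretation fun_vs: vector_space fun_scale
  by unfold_locales (simp_all add: fun_scale_def fun_eq_iff algebra_simps)


section \<open>Congruence subgroups\<close>

text \<open>All matrices are rational, so that subgroups of SL(2,Z) can be conjugated inside GL(2,Q).\<close>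

type_synonym mat2 = "rat^2^2"

definition SL2Z :: "mat2 set"
  where "SL2Z = {M. (\<forall>i j. M $ i $ j \<in> \<int>) \<and> det M = 1}"

definition principal_congruence_subgroup :: "nat \<Rightarrow> mat2 set"
  where "principal_congruence_subgroup N =
    {M \<in> SL2Z. \<forall>i j. \<exists>k :: int. M $ i $ j - (mat 1 :: mat2) $ i $ j = of_int (int N * k)}"

definition congruence_subgroup :: "mat2 set \<Rightarrow> bool"
  where "congruence_subgroup \<Gamma> \<longleftrightarrow>
    \<Gamma> \<subseteq> SL2Z \<and> mat 1 \<in> \<Gamma> \<and> (\<forall>A\<in>\<Gamma>. \<forall>B\<in>\<Gamma>. A ** B \<in> \<Gamma>) \<and> (\<forall>A\<in>\<Gamma>. matrix_inv A \<in> \<Gamma>) \<and>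
    (\<exists>N\<ge>1. principal_congruence_subgroup N \<subseteq> \<Gamma>)"

definition hecke_subgroup :: "mat2 set \<Rightarrow> mat2 \<Rightarrow> mat2 set"
  where "hecke_subgroup \<Gamma> \<alpha> = \<Gamma> \<inter> {matrix_inv \<alpha> ** \<gamma> ** \<alpha> | \<gamma>. \<gamma> \<in> \<Gamma>}"

definition right_cosets :: "mat2 set \<Rightarrow> mat2 set \<Rightarrow> mat2 set set"
  where "right_cosets \<Gamma>' \<Gamma> = (\<lambda>\<gamma>. (\<lambda>\<delta>. \<delta> ** \<gamma>) ` \<Gamma>') ` \<Gamma>"


section \<open>Modular forms\<close>

definition automorphy :: "mat2 \<Rightarrow> upper_half_plane \<Rightarrow> complex"
  where "automorphy M \<tau> = of_rat (M $ 2 $ 1) * of_uhp \<tau> + of_rat (M $ 2 $ 2)"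

text \<open>Only meaningful for matrices of positive determinant.\<close>

definition moebius :: "mat2 \<Rightarrow> upper_half_plane \<Rightarrow> upper_half_plane"
  where "moebius M \<tau> =
    Abs_uhp ((of_rat (M $ 1 $ 1) * of_uhp \<tau> + of_rat (M $ 1 $ 2)) / automorphy M \<tau>)"

text \<open>The slash operator carries no determinant factor.\<close>

definition slash :: "nat \<Rightarrow> (upper_half_plane \<Rightarrow> complex) \<Rightarrow> mat2 \<Rightarrow> upper_half_plane \<Rightarrow> complex"
  where "slash \<kappa> f M = (\<lambda>\<tau>. f (moebius M \<tau>) / automorphy M \<tau> ^ \<kappa>)"

text \<open>
  The function \<open>f\<close> equals \<open>\<Sum>\<^sub>n a\<^sub>n q\<^bsup>n/N\<^esup>\<close>, where \<open>q\<^bsup>1/N\<^esup> = exp (2\<pi>i\<tau>/N)\<close>. For a given \<open>N\<close> the coefficients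
  are uniquely determined, and replacing \<open>N\<close> by a multiple only inserts zeros.
\<close>

definition has_q_expansion :: "(upper_half_plane \<Rightarrow> complex) \<Rightarrow> nat \<Rightarrow> (nat \<Rightarrow> complex) \<Rightarrow> bool"
  where "has_q_expansion f N a \<longleftrightarrow>
    N \<ge> 1 \<and>
    (\<forall>\<tau>. (\<lambda>n. a n * exp (2 * of_real pi * \<i> * of_nat n * of_uhp \<tau> / of_nat N)) sums f \<tau>)"

definition q_coeffs_in :: "complex set \<Rightarrow> (upper_half_plane \<Rightarrow> complex) \<Rightarrow> bool"
  where "q_coeffs_in L f \<longleftrightarrow> (\<exists>N a. has_q_expansion f N a \<and> (\<forall>n. a n \<in> L))"

text \<open>
  Holomorphy at the cusps: every translate by SL(2,Z) has an expansion in nonnegative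
  (possibly fractional) powers of \<open>q\<close>.
\<close>

definition modular_forms :: "nat \<Rightarrow> mat2 set \<Rightarrow> (upper_half_plane \<Rightarrow> complex) set"
  where "modular_forms \<kappa> \<Gamma> = {f.
    (\<lambda>z. f (Abs_uhp z)) holomorphic_on {z. Im z > 0} \<and>
    (\<forall>\<gamma>\<in>\<Gamma>. slash \<kappa> f \<gamma> = f) \<and>
    (\<forall>\<gamma>\<in>SL2Z. \<exists>N a. has_q_expansion (slash \<kappa> f \<gamma>) N a)}"

text \<open>
  The direct sum of the spaces of modular forms: finitely supported families indexed by the weight,
  multiplied by convolution.
\<close>

type_synonym graded_form = "nat \<Rightarrow>\<^sub>0 (upper_half_plane \<Rightarrow> complex)"

definition graded_ring :: "mat2 set \<Rightarrow> graded_form set"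
  where "graded_ring \<Gamma> = {F. \<forall>\<kappa>. Poly_Mapping.lookup F \<kappa> \<in> modular_forms \<kappa> \<Gamma>}"

definition graded_const :: "complex \<Rightarrow> graded_form"
  where "graded_const c = Poly_Mapping.single 0 (\<lambda>_. c)"


section \<open>The Hecke operator\<close>

definition prime_form ::
    "complex \<Rightarrow> mat2 \<Rightarrow> nat \<Rightarrow> (upper_half_plane \<Rightarrow> complex) \<Rightarrow> upper_half_plane \<Rightarrow> complex"
  where "prime_form C \<alpha> \<kappa> f = fun_scale (C ^ \<kappa>) (slash \<kappa> f \<alpha>)"

text \<open>
  The sum is over one representative of each coset; the choice is irrelevant for
  \<open>f \<in> modular_forms \<kappa> \<Gamma>\<close>.
\<close>

definition hecke ::
    "mat2 set \<Rightarrow> mat2 \<Rightarrow> complex \<Rightarrow> complex \<Rightarrow> nat \<Rightarrow>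
      (upper_half_plane \<Rightarrow> complex) \<Rightarrow> upper_half_plane \<Rightarrow> complex"
  where "hecke \<Gamma> \<alpha> C c\<^sub>0 \<kappa> f =
    fun_scale c\<^sub>0
      (\<Sum>K\<in>right_cosets (hecke_subgroup \<Gamma> \<alpha>) \<Gamma>. slash \<kappa> (prime_form C \<alpha> \<kappa> f) (SOME \<gamma>. \<gamma> \<in> K))"


section \<open>Coefficient field\<close>

definition subfield_of_complex :: "complex set \<Rightarrow> bool"
  where "subfield_of_complex L \<longleftrightarrow>
    0 \<in> L \<and> 1 \<in> L \<and> (\<forall>x\<in>L. \<forall>y\<in>L. x + y \<in> L \<and> x * y \<in> L) \<and> (\<forall>x\<in>L. - x \<in> L \<and> inverse x \<in> L)"

definition has_basis_over :: "complex set \<Rightarrow> (upper_half_plane \<Rightarrow> complex) set \<Rightarrow> bool"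
  where "has_basis_over L V \<longleftrightarrow>
    (\<exists>B. fun_vs.independent B \<and> fun_vs.span B = V \<and> (\<forall>f\<in>B. q_coeffs_in L f))"


section \<open>Polynomials, term orders and power series\<close>

text \<open>Polynomials in indeterminates indexed by \<open>'i\<close>; monomials are represented by their exponents.\<close>

type_synonym ('i, 'a) mpoly = "('i \<Rightarrow>\<^sub>0 nat) \<Rightarrow>\<^sub>0 'a"

definition mpoly_eval ::
    "('a::zero \<Rightarrow> 'b::comm_ring_1) \<Rightarrow> ('i \<Rightarrow> 'b) \<Rightarrow> ('i, 'a) mpoly \<Rightarrow> 'b"
  where "mpoly_eval \<phi> x p =
    (\<Sum>m\<in>Poly_Mapping.keys p.
      \<phi> (Poly_Mapping.lookup p m) * (\<Prod>i\<in>Poly_Mapping.keys m. x i ^ Poly_Mapping.lookup m i))"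

definition relation_ideal ::
    "('r \<Rightarrow> nat) \<Rightarrow> ('r \<Rightarrow> upper_half_plane \<Rightarrow> complex) \<Rightarrow> ('r, complex) mpoly set"
  where "relation_ideal wt a =
    {p. mpoly_eval graded_const (\<lambda>i. Poly_Mapping.single (wt i) (a i)) p = 0}"

text \<open>\<open>(s, t) \<in> ord\<close> means that \<open>s\<close> is at most \<open>t\<close>.\<close>

definition term_order :: "('r \<Rightarrow>\<^sub>0 nat) rel \<Rightarrow> bool"
  where "term_order ord \<longleftrightarrow>
    well_order_on UNIV ord \<and> (\<forall>s t u. (s, t) \<in> ord \<longrightarrow> (s + u, t + u) \<in> ord)"

definition leading_exponent :: "('r \<Rightarrow>\<^sub>0 nat) rel \<Rightarrow> ('r, complex) mpoly \<Rightarrow> 'r \<Rightarrow>\<^sub>0 nat"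
  where "leading_exponent ord p =
    (THE s. s \<in> Poly_Mapping.keys p \<and> (\<forall>t\<in>Poly_Mapping.keys p. (t, s) \<in> ord))"

global_interpretation ideal: module "(*) :: 'a::comm_ring_1 \<Rightarrow> 'a \<Rightarrow> 'a"
  by unfold_locales (simp_all add: algebra_simps)

definition initial_ideal ::
    "('r \<Rightarrow>\<^sub>0 nat) rel \<Rightarrow> ('r, complex) mpoly set \<Rightarrow> ('r, complex) mpoly set"
  where "initial_ideal ord I =
    ideal.span {Poly_Mapping.single (leading_exponent ord p) 1 | p. p \<in> I \<and> p \<noteq> 0}"

definition standard_exponents ::
    "('r \<Rightarrow>\<^sub>0 nat) rel \<Rightarrow> ('r, complex) mpoly set \<Rightarrow> ('r \<Rightarrow>\<^sub>0 nat) set"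
  where "standard_exponents ord I = {e. Poly_Mapping.single e 1 \<notin> initial_ideal ord I}"

text \<open>Multivariate formal power series, given by their coefficient functions.\<close>

type_synonym ('i, 'a) mpseries = "('i \<Rightarrow>\<^sub>0 nat) \<Rightarrow> 'a"

definition mpseries_mult ::
    "('i, 'a::comm_ring_1) mpseries \<Rightarrow> ('i, 'a) mpseries \<Rightarrow> ('i, 'a) mpseries"
  where "mpseries_mult F G = (\<lambda>n. \<Sum>(k, l) \<in> {(k, l). k + l = n}. F k * G l)"


section \<open>The generating function\<close>

definition hecke_generating_function ::
    "mat2 set \<Rightarrow> mat2 \<Rightarrow> complex \<Rightarrow> complex \<Rightarrow> ('r \<Rightarrow>\<^sub>0 nat) rel \<Rightarrow>
      ('r::finite \<Rightarrow> nat) \<Rightarrow> ('r \<Rightarrow> upper_half_plane \<Rightarrow> complex) \<Rightarrow> ('r, graded_form) mpseries"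
  where "hecke_generating_function \<Gamma> \<alpha> C c\<^sub>0 ord wt a = (\<lambda>e.
    if e \<in> standard_exponents ord (relation_ideal wt a)
    then (let \<kappa> = \<Sum>i\<in>UNIV. Poly_Mapping.lookup e i * wt i
          in Poly_Mapping.single \<kappa> (hecke \<Gamma> \<alpha> C c\<^sub>0 \<kappa> (\<Prod>i\<in>UNIV. a i ^ Poly_Mapping.lookup e i)))
    else 0)"

text \<open>
  The image in \<open>\<R>\<^sub>\<Gamma>[A\<^sub>1,\<dots>,A\<^sub>r]\<close> of a polynomial in the \<open>2r\<close> indeterminates \<open>a\<^sub>i\<close> (indexed by \<open>Inl i\<close>)
  and \<open>A\<^sub>i\<close> (indexed by \<open>Inr i\<close>): the former are sent to the generators, the latter are kept.
\<close>

definition image_over_graded_ring ::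
    "('r \<Rightarrow> nat) \<Rightarrow> ('r \<Rightarrow> upper_half_plane \<Rightarrow> complex) \<Rightarrow>
      ('r + 'r, complex) mpoly \<Rightarrow> ('r, graded_form) mpoly"
  where "image_over_graded_ring wt a =
    mpoly_eval (\<lambda>c. Poly_Mapping.single 0 (graded_const c))
      (case_sum (\<lambda>i. Poly_Mapping.single 0 (Poly_Mapping.single (wt i) (a i)))
                (\<lambda>i. Poly_Mapping.single (Poly_Mapping.single i 1) 1))"

end

theory Submission
  imports Defs "HOL-Complex_Analysis.Conformal_Mappings"
begin

text \<open>
  For \<open>\<gamma> \<in> \<Gamma>\<close> the map \<open>f \<mapsto> f'|\<gamma>\<close> is multiplicative. Let \<open>x\<^sub>i\<close> be the image of \<open>a\<^sub>i\<close>. Then the part of the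
  generating function that belongs to the coset of \<open>\<gamma>\<close> is the sum of the monomials
  \<open>(A\<^sub>1 x\<^sub>1)\<^bsup>i\<^sub>1\<^esup> \<dots> (A\<^sub>r x\<^sub>r)\<^bsup>i\<^sub>r\<^esup>\<close> over the exponents in \<open>\<B>\<close>. The set \<open>\<B>\<close> is the complement of a monomial
  ideal, so by Dickson's lemma membership in \<open>\<B>\<close> no longer changes in direction \<open>i\<close> when the exponent of
  \<open>A\<^sub>i\<close> is large (\<open>standard_exponents_stabilize\<close>). In that range the coefficients are sums over the cosets
  of geometric progressions with ratios \<open>x\<^sub>i\<close>, and the polynomial \<open>\<Prod>\<^sub>g (1 - A\<^sub>i g)\<close> over the finite set of
  all conjugates \<open>g = a\<^sub>i'|\<gamma>\<close> annihilates them (\<open>hecke_recurrence\<close>). The product of these \<open>r\<close> Euler factors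
  is the denominator \<open>Q\<close>: its product with the generating function has finite support
  (\<open>ex_denominator\<close>).

  It remains to see that everything is defined over \<open>L\<close>. The coefficients of the Euler factors are
  those of the characteristic polynomial of the set of conjugates of \<open>f'\<close>, with \<open>f = a\<^sub>i\<close>. They are
  modular forms for \<open>\<Gamma>\<close> because \<open>\<Gamma>\<close> permutes the conjugates. For their rationality, let \<open>\<rho>\<close> be an
  \<open>L\<close>-linear retraction of \<open>\<complex>\<close> onto \<open>L\<close> and apply it to \<open>q\<close>-coefficients. It maps the spaces of modular
  forms for \<open>\<Gamma>\<close> to themselves, because they are spanned by monomials in the rational forms \<open>a\<^sub>i\<close>. As \<open>f'\<close>
  is rational, it is a root of the characteristic polynomial and of its image under \<open>\<rho>\<close>. Then all
  conjugates are roots of both, and both are monic of the same degree, so they coincide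
  (\<open>char_poly_coeff_rational\<close>).

  The same argument for any form \<open>f\<close> shows that Hecke operators preserve modularity and rationality,
  since the sum of the conjugates of \<open>f'\<close> is one of these coefficients (\<open>hecke_eq_subleading\<close>). Hence the
  numerator \<open>Q * F\<close> is rational together with \<open>Q\<close> and \<open>F\<close>. Finally, rational forms are polynomials in the
  generators with coefficients in \<open>L\<close>, again by the retraction (\<open>rational_form_combination\<close>), and this
  turns \<open>Q\<close> and \<open>Q * F\<close> into polynomials in the \<open>2r\<close> indeterminates.
\<close>

section \<open>Pointwise operations on functions\<close>

lemma fun_power_apply: "(f ^ n) x = f x ^ n" for f :: "'a \<Rightarrow> 'b::comm_ring_1"
  by (induction n) auto

lemma fun_sum_apply: "(\<Sum>i\<in>A. f i) x = (\<Sum>i\<in>A. f i x)" for f :: "'i \<Rightarrow> 'a \<Rightarrow> 'b::comm_ring_1"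
  by (induction A rule: infinite_finite_induct) auto

lemma fun_prod_apply: "(\<Prod>i\<in>A. f i) x = (\<Prod>i\<in>A. f i x)" for f :: "'i \<Rightarrow> 'a \<Rightarrow> 'b::comm_ring_1"
  by (induction A rule: infinite_finite_induct) auto

lemma fun_scale_eq_mult: "fun_scale c f = (\<lambda>_. c) * f"
  by (simp add: fun_scale_def fun_eq_iff)


section \<open>The slash operator\<close>

lemma Im_of_uhp_pos: "Im (of_uhp \<tau>) > 0"
  using of_uhp[of \<tau>] by simp

lemma of_uhp_Abs_uhp: "Im z > 0 \<Longrightarrow> of_uhp (Abs_uhp z) = z"
  by (simp add: Abs_uhp_inverse)

lemma of_rat_eq_of_real: "(of_rat x :: complex) = of_real (of_rat x)"
proof -
  obtain a b where "x = Fract a b" "b > 0"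
    using Rat_cases by blast
  thus ?thesis
    by (simp add: of_rat_rat)
qed

lemma Re_of_rat [simp]: "Re (of_rat x) = of_rat x"
  by (simp add: of_rat_eq_of_real)

lemma Im_of_rat [simp]: "Im (of_rat x) = 0"
  by (simp add: of_rat_eq_of_real)

lemma linear_form_nonzero:
  fixes a b c d :: rat
  assumes "Im z > 0" "a * d - b * c \<noteq> 0"
  shows "of_rat c * z + of_rat d \<noteq> (0 :: complex)"
proof
  assume eq: "of_rat c * z + of_rat d = (0 :: complex)"
  hence "of_rat c * Im z = 0"
    by (simp add: complex_eq_iff)
  with assms(1) have "c = 0" by auto
  with eq have "d = 0" by simp
  with \<open>c = 0\<close> assms(2) show False by simp
qed

lemma Im_moebius_pos:
  fixes a b c d :: rat
  assumes "Im z > 0" "a * d - b * c > 0"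
  shows "Im ((of_rat a * z + of_rat b) / (of_rat c * z + of_rat d)) > 0"
proof -
  let ?w = "of_rat c * z + of_rat d"
  have nz: "?w \<noteq> 0" using linear_form_nonzero[of z a d b c] assms by auto
  have "Im (of_rat a * z + of_rat b) * Re ?w - Re (of_rat a * z + of_rat b) * Im ?w =
      of_rat (a * d - b * c) * Im z"
    by (simp add: of_rat_diff of_rat_mult ring_distribs)
  hence "Im ((of_rat a * z + of_rat b) / ?w) = of_rat (a * d - b * c) * Im z / (norm ?w)\<^sup>2"
    unfolding Im_divide cmod_power2 by (simp only:)
  also have "\<dots> > 0"
    using assms nz by (intro divide_pos_pos mult_pos_pos) auto
  finally show ?thesis .
qed

lemma automorphy_nonzero: "det M > 0 \<Longrightarrow> automorphy M \<tau> \<noteq> 0"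
  unfolding automorphy_def
  by (rule linear_form_nonzero[of _ "M $ 1 $ 1" _ "M $ 1 $ 2"]) (auto simp: Im_of_uhp_pos det_2)

lemma of_uhp_moebius:
  assumes "det M > 0"
  shows "of_uhp (moebius M \<tau>) =
    (of_rat (M $ 1 $ 1) * of_uhp \<tau> + of_rat (M $ 1 $ 2)) / automorphy M \<tau>"
  unfolding moebius_def automorphy_def
  by (rule of_uhp_Abs_uhp, rule Im_moebius_pos) (use assms in \<open>auto simp: Im_of_uhp_pos det_2\<close>)

lemma mat2_mult_nth: "(A ** B) $ i $ j = A $ i $ 1 * B $ 1 $ j + A $ i $ 2 * B $ 2 $ j"
  for A B :: mat2
  by (simp add: matrix_matrix_mult_def sum_2)

lemma automorphy_mult:
  assumes "det B > 0"
  shows "automorphy (A ** B) \<tau> = automorphy A (moebius B \<tau>) * automorphy B \<tau>"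
proof -
  define w where "w = of_rat (B $ 1 $ 1) * of_uhp \<tau> + of_rat (B $ 1 $ 2)"
  define v where "v = automorphy B \<tau>"
  have "v \<noteq> 0" using automorphy_nonzero[OF assms] by (simp add: v_def)
  hence "automorphy A (moebius B \<tau>) * v = of_rat (A $ 2 $ 1) * w + of_rat (A $ 2 $ 2) * v"
    unfolding automorphy_def[of A] of_uhp_moebius[OF assms]
    by (simp add: w_def [symmetric] v_def [symmetric] ring_distribs)
  also have "\<dots> = automorphy (A ** B) \<tau>"
    by (simp add: mat2_mult_nth of_rat_add of_rat_mult w_def v_def automorphy_def ring_distribs)
  finally show ?thesis by (simp add: v_def)
qed

lemma moebius_mult:
  assumes "det A > 0" "det B > 0"
  shows "moebius (A ** B) \<tau> = moebius A (moebius B \<tau>)"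
proof -
  have "det (A ** B) > 0" using assms by (simp add: det_mul)
  define w where "w = of_rat (B $ 1 $ 1) * of_uhp \<tau> + of_rat (B $ 1 $ 2)"
  define v where "v = automorphy B \<tau>"
  have "v \<noteq> 0" using automorphy_nonzero[OF assms(2)] by (simp add: v_def)
  hence "of_rat (A $ 1 $ 1) * (w / v) + of_rat (A $ 1 $ 2) =
      (of_rat (A $ 1 $ 1) * w + of_rat (A $ 1 $ 2) * v) / v"
    by (simp add: add_divide_distrib)
  moreover have "of_rat (A $ 1 $ 1) * w + of_rat (A $ 1 $ 2) * v =
      of_rat ((A ** B) $ 1 $ 1) * of_uhp \<tau> + of_rat ((A ** B) $ 1 $ 2)"
    by (simp add: mat2_mult_nth of_rat_add of_rat_mult w_def v_def automorphy_def ring_distribs)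
  ultimately have "of_uhp (moebius (A ** B) \<tau>) = of_uhp (moebius A (moebius B \<tau>))"
    unfolding of_uhp_moebius[OF \<open>det (A ** B) > 0\<close>] of_uhp_moebius[OF assms(1)] of_uhp_moebius[OF assms(2)]
      automorphy_mult[OF assms(2)]
    by (simp add: w_def v_def mult.commute)
  thus ?thesis by (simp add: of_uhp_inject)
qed

lemma slash_slash:
  assumes "det A > 0" "det B > 0"
  shows "slash \<kappa> (slash \<kappa> f A) B = slash \<kappa> f (A ** B)"
  by (simp add: slash_def fun_eq_iff moebius_mult[OF assms] automorphy_mult[OF assms(2)] power_mult_distrib)

lemma slash_mat_1 [simp]: "slash \<kappa> f (mat 1) = f"
  by (simp add: slash_def fun_eq_iff moebius_def automorphy_def mat_def of_uhp_inverse)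

lemma slash_add: "slash \<kappa> (f + g) M = slash \<kappa> f M + slash \<kappa> g M"
  for f :: "upper_half_plane \<Rightarrow> complex"
  by (simp add: slash_def fun_eq_iff add_divide_distrib)

lemma slash_uminus: "slash \<kappa> (- f) M = - slash \<kappa> f M"
  for f :: "upper_half_plane \<Rightarrow> complex"
  by (simp add: slash_def fun_eq_iff)

lemma slash_zero [simp]: "slash \<kappa> 0 M = 0"
  by (simp add: slash_def fun_eq_iff)

lemma slash_mult: "slash (\<kappa> + \<kappa>') (f * g) M = slash \<kappa> f M * slash \<kappa>' g M"
  for f :: "upper_half_plane \<Rightarrow> complex"
  by (simp add: slash_def fun_eq_iff power_add)

lemma slash_scale: "slash \<kappa> (fun_scale c f) M = fun_scale c (slash \<kappa> f M)"
  by (simp add: slash_def fun_eq_iff fun_scale_def)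

lemma slash_const [simp]: "slash 0 (\<lambda>_. c) M = (\<lambda>_. c)"
  by (simp add: slash_def fun_eq_iff)

lemma slash_one [simp]: "slash 0 1 M = 1"
  by (simp add: slash_def fun_eq_iff)

lemma slash_sum: "slash \<kappa> (\<Sum>i\<in>A. f i) M = (\<Sum>i\<in>A. slash \<kappa> (f i) M)"
  for f :: "'i \<Rightarrow> upper_half_plane \<Rightarrow> complex"
  by (simp add: slash_def fun_eq_iff fun_sum_apply sum_divide_distrib)

lemma slash_power: "slash (n * \<kappa>) (f ^ n) M = slash \<kappa> f M ^ n"
  for f :: "upper_half_plane \<Rightarrow> complex"
  by (simp add: slash_def fun_eq_iff fun_power_apply power_divide power_mult [symmetric] mult.commute)

lemma slash_prod: "slash (\<Sum>i\<in>A. \<kappa> i) (\<Prod>i\<in>A. f i) M = (\<Prod>i\<in>A. slash (\<kappa> i) (f i) M)"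
  for f :: "'i \<Rightarrow> upper_half_plane \<Rightarrow> complex"
  by (simp add: slash_def fun_eq_iff fun_prod_apply prod_dividef power_sum)


section \<open>Expansions in fractional powers of \<open>q\<close>\<close>

definition q_root :: "nat \<Rightarrow> upper_half_plane \<Rightarrow> complex"
  where "q_root N \<tau> = exp (2 * of_real pi * \<i> * of_uhp \<tau> / of_nat N)"

lemma q_root_power: "exp (2 * of_real pi * \<i> * of_nat n * of_uhp \<tau> / of_nat N) = q_root N \<tau> ^ n"
  unfolding q_root_def exp_of_nat_mult [symmetric]
  by (rule arg_cong[where f = exp]) (simp only: mult_ac times_divide_eq_right times_divide_eq_left)

lemma has_q_expansion_iff:
  "has_q_expansion f N u \<longleftrightarrow> N \<ge> 1 \<and> (\<forall>\<tau>. (\<lambda>n. u n * q_root N \<tau> ^ n) sums f \<tau>)"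
  by (simp add: has_q_expansion_def q_root_power)

lemma q_root_surj:
  assumes "N \<ge> 1" "z \<noteq> 0" "norm z < 1"
  obtains \<tau> where "q_root N \<tau> = z"
proof
  define w where "w = - (\<i> * (of_real (real N / (2 * pi)) * Ln z))"
  have "Re (Ln z) < 0" using assms by simp
  hence "Im w > 0"
    using assms(1) unfolding w_def by (simp add: mult_pos_neg divide_neg_pos)
  hence "of_uhp (Abs_uhp w) = w" by (rule of_uhp_Abs_uhp)
  moreover have "2 * of_real pi * \<i> * w / of_nat N = (of_real (2 * pi * (real N / (2 * pi)) / real N)) * Ln z"
    unfolding w_def by (simp only: of_real_mult of_real_divide of_real_numeral of_real_of_nat_eq) simp
  moreover have "2 * pi * (real N / (2 * pi)) / real N = 1"
    using assms(1) by simp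
  ultimately show "q_root N (Abs_uhp w) = z"
    using assms(2) by (simp add: q_root_def)
qed

lemma norm_q_root:
  assumes "N \<ge> 1"
  shows "norm (q_root N \<tau>) < 1"
proof -
  have "Re (2 * of_real pi * \<i> * of_uhp \<tau> / of_nat N) = - (2 * pi * Im (of_uhp \<tau>) / real N)"
    by simp
  also have "\<dots> < 0"
    using assms Im_of_uhp_pos[of \<tau>] by simp
  finally show ?thesis
    unfolding q_root_def norm_exp_eq_Re by simp
qed

lemma q_root_mult: "k \<ge> 1 \<Longrightarrow> q_root (N * k) \<tau> ^ k = q_root N \<tau>"
  unfolding q_root_def exp_of_nat_mult [symmetric]
  by (rule arg_cong[where f = exp]) simp

text \<open>
  A power series converges absolutely inside its circle of convergence, and the expansion also
  converges at a point where \<open>q\<^bsup>1/N\<^esup>\<close> has a larger modulus.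
\<close>

lemma q_expansion_summable_norm:
  assumes "has_q_expansion f N u"
  shows "summable (\<lambda>n. norm (u n * q_root N \<tau> ^ n))"
proof -
  have N: "N \<ge> 1" using assms by (simp add: has_q_expansion_iff)
  define r where "r = (1 + norm (q_root N \<tau>)) / 2"
  have r: "norm (q_root N \<tau>) < r" "r < 1" "r > 0"
    using norm_q_root[OF N, of \<tau>] norm_ge_zero[of "q_root N \<tau>"] unfolding r_def by (simp_all add: add_pos_nonneg)
  obtain \<tau>' where \<tau>': "q_root N \<tau>' = of_real r"
    using q_root_surj[of N "of_real r"] N r by auto
  have "summable (\<lambda>n. u n * (of_real r) ^ n)"
    using assms \<tau>' by (metis has_q_expansion_iff sums_summable)
  thus ?thesis
    by (rule powser_insidea) (use r in auto)
qed


text \<open>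
  The nome \<open>q\<^bsup>1/N\<^esup>\<close> takes every value of the punctured unit disc, so this is the identity
  theorem for power series.
\<close>

lemma q_expansion_zero_imp_coeffs_zero:
  assumes "has_q_expansion 0 N u"
  shows "u n = 0"
proof (rule ccontr)
  assume nz: "u n \<noteq> 0"
  have N: "N \<ge> 1" using assms by (simp add: has_q_expansion_iff)
  \<comment> \<open>Multiplication by the variable makes the series vanish at the origin as well.\<close>
  define v where "v = (\<lambda>k. case k of 0 \<Rightarrow> 0 | Suc m \<Rightarrow> u m)"
  have v0: "v 0 = 0" and vSuc: "v (Suc k) = u k" for k
    by (simp_all add: v_def)
  have sums: "(\<lambda>k. v k * (z - 0) ^ k) sums 0" if "norm (z - 0) < 1" for z
  proof (cases "z = 0")
    case True
    have "v k * (z - 0) ^ k = 0" for k using True by (cases k) (auto simp: v0)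
    thus ?thesis by (simp only: sums_zero)
  next
    case False
    have "norm z < 1" using that by simp
    then obtain \<tau> where \<tau>: "q_root N \<tau> = z" using q_root_surj[OF N False] by blast
    have "(\<lambda>k. u k * z ^ k) sums 0" using assms \<tau> by (auto simp: has_q_expansion_iff)
    hence "(\<lambda>k. z * (u k * z ^ k)) sums (z * 0)" by (rule sums_mult)
    moreover have "v (Suc k) * z ^ Suc k = z * (u k * z ^ k)" for k
      by (simp add: vSuc)
    ultimately have "(\<lambda>k. v (Suc k) * z ^ Suc k) sums 0"
      by (simp only: mult_zero_right)
    hence "(\<lambda>k. v k * z ^ k) sums (0 + v 0 * z ^ 0)"
      by (rule sums_Suc_iff[THEN iffD1])
    thus ?thesis by (simp add: v0)
  qed
  show False
  proof (rule powser_0_nonzero[of 1 0 v "\<lambda>_. 0" "Suc n"])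
    fix s :: real
    assume "0 < s" and *: "\<And>z :: complex. z \<in> cball 0 s - {0} \<Longrightarrow> 0 \<noteq> (0 :: complex)"
    from *[of "of_real s"] \<open>0 < s\<close> show False by simp
  qed (use sums nz in \<open>simp_all add: vSuc\<close>)
qed

lemma has_q_expansion_add:
  assumes "has_q_expansion f N u" "has_q_expansion g N v"
  shows "has_q_expansion (f + g) N (\<lambda>n. u n + v n)"
  using assms unfolding has_q_expansion_iff distrib_right plus_fun_apply
  by (intro conjI allI sums_add) auto

lemma has_q_expansion_scale:
  assumes "has_q_expansion f N u"
  shows "has_q_expansion (fun_scale c f) N (\<lambda>n. c * u n)"
  using assms unfolding has_q_expansion_iff mult.assoc fun_scale_def
  by (intro conjI allI sums_mult) auto

lemma has_q_expansion_unique: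
  assumes "has_q_expansion f N u" "has_q_expansion f N v"
  shows "u = v"
proof
  fix n
  have "has_q_expansion 0 N (\<lambda>n. u n - v n)"
    using has_q_expansion_add[OF assms(1) has_q_expansion_scale[OF assms(2), of "-1"]]
    by (simp add: fun_scale_def plus_fun_def zero_fun_def)
  from q_expansion_zero_imp_coeffs_zero[OF this, of n] show "u n = v n" by simp
qed

lemma has_q_expansion_fun_unique:
  assumes "has_q_expansion f N u" "has_q_expansion g N u"
  shows "f = g"
  using assms by (auto simp: has_q_expansion_iff fun_eq_iff intro: sums_unique2)

lemma has_q_expansion_mult:
  assumes "has_q_expansion f N u" "has_q_expansion g N v"
  shows "has_q_expansion (f * g) N (\<lambda>n. \<Sum>i\<le>n. u i * v (n - i))"
  unfolding has_q_expansion_iff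
proof (intro conjI allI)
  show "N \<ge> 1" using assms(1) by (simp add: has_q_expansion_iff)
  fix \<tau>
  have eq: "(\<lambda>n. u n * q_root N \<tau> ^ n) sums f \<tau>" "(\<lambda>n. v n * q_root N \<tau> ^ n) sums g \<tau>"
    using assms by (auto simp: has_q_expansion_iff)
  define A where "A = (\<lambda>n. u n * q_root N \<tau> ^ n)"
  define B where "B = (\<lambda>n. v n * q_root N \<tau> ^ n)"
  have "(\<lambda>k. \<Sum>i\<le>k. A i * B (k - i)) sums (suminf A * suminf B)"
    unfolding A_def B_def by (rule Cauchy_product_sums; rule q_expansion_summable_norm) fact+
  moreover have "(\<Sum>i\<le>k. A i * B (k - i)) = (\<Sum>i\<le>k. u i * v (k - i)) * q_root N \<tau> ^ k" for k
  proof -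
    have "A i * B (k - i) = u i * v (k - i) * q_root N \<tau> ^ k" if "i \<le> k" for i
    proof -
      have "q_root N \<tau> ^ k = q_root N \<tau> ^ i * q_root N \<tau> ^ (k - i)"
        using that by (simp flip: power_add)
      thus ?thesis by (simp add: A_def B_def)
    qed
    thus ?thesis
      unfolding sum_distrib_right by (intro sum.cong) auto
  qed
  moreover have "suminf A = f \<tau>" "suminf B = g \<tau>"
    using eq by (auto simp: sums_iff A_def B_def)
  ultimately show "(\<lambda>n. (\<Sum>i\<le>n. u i * v (n - i)) * q_root N \<tau> ^ n) sums ((f * g) \<tau>)"
    by simp
qed

text \<open>
  The coefficients of the same series with respect to a \<open>k\<close>-th root of its variable.
\<close>

definition spread_coeffs :: "nat \<Rightarrow> (nat \<Rightarrow> complex) \<Rightarrow> nat \<Rightarrow> complex"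
  where "spread_coeffs k u n = (if k dvd n then u (n div k) else 0)"

lemma spread_coeffs_sums:
  assumes "k \<ge> 1"
  shows "(\<lambda>n. spread_coeffs k u n * z ^ n) sums s \<longleftrightarrow> (\<lambda>n. u n * (z ^ k) ^ n) sums s"
proof -
  have "(\<lambda>n. spread_coeffs k u (k * n) * z ^ (k * n)) sums s \<longleftrightarrow>
      (\<lambda>n. spread_coeffs k u n * z ^ n) sums s"
    by (rule sums_mono_reindex[of "\<lambda>n. k * n"])
       (use assms in \<open>auto simp: strict_mono_def spread_coeffs_def elim!: dvdE\<close>)
  thus ?thesis using assms by (simp add: spread_coeffs_def power_mult)
qed

lemma has_q_expansion_spread:
  assumes "has_q_expansion f N u" "k \<ge> 1"
  shows "has_q_expansion f (N * k) (spread_coeffs k u)"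
  using assms by (auto simp: has_q_expansion_iff spread_coeffs_sums q_root_mult)

lemma has_q_expansion_common:
  assumes "has_q_expansion f N u" "has_q_expansion g M v"
  shows "has_q_expansion f (N * M) (spread_coeffs M u)" "has_q_expansion g (N * M) (spread_coeffs N v)"
  using has_q_expansion_spread[OF assms(1), of M] has_q_expansion_spread[OF assms(2), of N] assms
  by (auto simp: has_q_expansion_iff mult.commute)

lemma has_q_expansion_const: "has_q_expansion (\<lambda>_. c) 1 (\<lambda>n. if n = 0 then c else 0)"
proof -
  have "(\<lambda>n. (if n = 0 then c else 0) * q_root 1 \<tau> ^ n) sums
      (\<Sum>n\<in>{0 :: nat}. (if n = 0 then c else 0) * q_root 1 \<tau> ^ n)" for \<tau>
    by (rule sums_finite) auto
  thus ?thesis by (simp add: has_q_expansion_iff)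
qed


section \<open>Holomorphic functions on the upper half plane\<close>

definition holomorphic_uhp :: "(upper_half_plane \<Rightarrow> complex) \<Rightarrow> bool"
  where "holomorphic_uhp f \<longleftrightarrow> (\<lambda>z. f (Abs_uhp z)) holomorphic_on {z. Im z > 0}"

lemma holomorphic_uhp_add: "holomorphic_uhp f \<Longrightarrow> holomorphic_uhp g \<Longrightarrow> holomorphic_uhp (f + g)"
  by (simp add: holomorphic_uhp_def holomorphic_on_add)

lemma holomorphic_uhp_diff: "holomorphic_uhp f \<Longrightarrow> holomorphic_uhp g \<Longrightarrow> holomorphic_uhp (f - g)"
  by (simp add: holomorphic_uhp_def holomorphic_on_diff)

lemma holomorphic_uhp_mult: "holomorphic_uhp f \<Longrightarrow> holomorphic_uhp g \<Longrightarrow> holomorphic_uhp (f * g)"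
  by (simp add: holomorphic_uhp_def holomorphic_on_mult)

lemma holomorphic_uhp_const [simp]: "holomorphic_uhp (\<lambda>_. c)"
  by (simp add: holomorphic_uhp_def)

lemma holomorphic_uhp_prod:
  assumes "\<And>i. i \<in> A \<Longrightarrow> holomorphic_uhp (f i)"
  shows "holomorphic_uhp (\<Prod>i\<in>A. f i)"
  using assms by (simp add: holomorphic_uhp_def fun_prod_apply holomorphic_on_prod)

lemma holomorphic_uhp_slash:
  assumes "holomorphic_uhp f" "det M > 0"
  shows "holomorphic_uhp (slash \<kappa> f M)"
proof -
  let ?H = "{z :: complex. Im z > 0}"
  let ?j = "\<lambda>z. of_rat (M $ 2 $ 1) * z + of_rat (M $ 2 $ 2) :: complex"
  let ?m = "\<lambda>z. (of_rat (M $ 1 $ 1) * z + of_rat (M $ 1 $ 2)) / ?j z"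
  have d: "M $ 1 $ 1 * M $ 2 $ 2 - M $ 1 $ 2 * M $ 2 $ 1 > 0"
    using assms(2) by (simp add: det_2)
  have nz: "?j z \<noteq> 0" if "z \<in> ?H" for z
    using linear_form_nonzero[of z "M $ 1 $ 1" "M $ 2 $ 2" "M $ 1 $ 2" "M $ 2 $ 1"] that d by auto
  have comp: "(\<lambda>z. f (Abs_uhp z)) \<circ> ?m holomorphic_on ?H"
  proof (rule holomorphic_on_compose_gen)
    show "?m holomorphic_on ?H"
      using nz by (intro holomorphic_intros) auto
    show "(\<lambda>z. f (Abs_uhp z)) holomorphic_on ?H"
      using assms(1) by (simp add: holomorphic_uhp_def)
    show "?m ` ?H \<subseteq> ?H"
      using Im_moebius_pos[OF _ d] by auto
  qed
  have "(\<lambda>z. ((\<lambda>z. f (Abs_uhp z)) \<circ> ?m) z / ?j z ^ \<kappa>) holomorphic_on ?H"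
    using nz by (intro holomorphic_on_divide[OF _ holomorphic_on_power] comp holomorphic_intros)
      (simp_all add: comp[unfolded o_def] o_def)
  thus ?thesis
    unfolding holomorphic_uhp_def
  proof (rule holomorphic_transform)
    fix z assume "z \<in> ?H"
    thus "((\<lambda>z. f (Abs_uhp z)) \<circ> ?m) z / ?j z ^ \<kappa> = slash \<kappa> f M (Abs_uhp z)"
      by (simp add: slash_def moebius_def automorphy_def of_uhp_Abs_uhp)
  qed
qed

text \<open>Zeros of a nonzero holomorphic function on a connected domain are isolated.\<close>

lemma holomorphic_uhp_no_zero_divisors:
  assumes "holomorphic_uhp f" "holomorphic_uhp g" "f * g = 0" "f \<noteq> 0"
  shows "g = 0"
proof -
  let ?H = "{z :: complex. Im z > 0}"
  have H: "open ?H" "connected ?H"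
    by (simp_all add: open_halfspace_Im_gt convex_halfspace_Im_gt convex_connected)
  obtain \<tau> where "f \<tau> \<noteq> 0" using assms(4) by (auto simp: fun_eq_iff)
  define U where "U = {z \<in> ?H. f (Abs_uhp z) \<noteq> 0}"
  have "continuous_on ?H (\<lambda>z. f (Abs_uhp z))"
    using assms(1) by (simp add: holomorphic_uhp_def holomorphic_on_imp_continuous_on)
  hence "open (?H \<inter> (\<lambda>z. f (Abs_uhp z)) -` (- {0}))"
    by (rule continuous_open_preimage[OF _ H(1)]) auto
  also have "?H \<inter> (\<lambda>z. f (Abs_uhp z)) -` (- {0}) = U"
    by (auto simp: U_def)
  finally have "open U" .
  moreover have "of_uhp \<tau> \<in> U"
    using \<open>f \<tau> \<noteq> 0\<close> by (simp add: U_def Im_of_uhp_pos of_uhp_inverse)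
  ultimately have "of_uhp \<tau> islimpt U"
    by (simp add: interior_limit_point interior_open)
  have "g (Abs_uhp w) = 0" if "w \<in> ?H" for w
  proof (rule analytic_continuation[OF _ H, of "\<lambda>z. g (Abs_uhp z)" U "of_uhp \<tau>"])
    show "(\<lambda>z. g (Abs_uhp z)) holomorphic_on ?H"
      using assms(2) by (simp add: holomorphic_uhp_def)
    show "g (Abs_uhp z) = 0" if "z \<in> U" for z
      using that fun_cong[OF assms(3), of "Abs_uhp z"] by (auto simp: U_def)
  qed (use that \<open>of_uhp \<tau> islimpt U\<close> in \<open>auto simp: U_def Im_of_uhp_pos\<close>)
  from this[of "of_uhp x" for x] show ?thesis
    by (simp add: fun_eq_iff of_uhp_inverse Im_of_uhp_pos)
qed

lemma holomorphic_uhp_prod_nonzero: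
  assumes "finite A" "\<And>i. i \<in> A \<Longrightarrow> holomorphic_uhp (f i)" "\<And>i. i \<in> A \<Longrightarrow> f i \<noteq> 0"
  shows "(\<Prod>i\<in>A. f i) \<noteq> 0"
  using assms
proof (induction A)
  case empty
  show ?case by (simp add: fun_eq_iff fun_prod_apply)
next
  case (insert x A)
  show ?case
  proof
    assume "(\<Prod>i\<in>insert x A. f i) = 0"
    hence "f x * (\<Prod>i\<in>A. f i) = 0" using insert.hyps by simp
    moreover have "holomorphic_uhp (f x)" "f x \<noteq> 0" "holomorphic_uhp (\<Prod>i\<in>A. f i)"
      using insert.prems by (blast intro: holomorphic_uhp_prod)+
    ultimately have "(\<Prod>i\<in>A. f i) = 0"
      using holomorphic_uhp_no_zero_divisors by blast
    moreover have "(\<Prod>i\<in>A. f i) \<noteq> 0"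
      by (rule insert.IH) (use insert.prems in blast)+
    ultimately show False by contradiction
  qed
qed

text \<open>
  A polynomial of degree less than \<open>n\<close> with \<open>n\<close> roots in a domain vanishes. The holomorphic
  functions are a domain, but do not form a type, so the roots are counted over \<open>\<complex>\<close> at every point
  where the given functions have distinct values. These points are the nonzeros of one nonzero
  holomorphic function.
\<close>

lemma holomorphic_many_roots_imp_coeffs_zero:
  fixes d :: "nat \<Rightarrow> upper_half_plane \<Rightarrow> complex"
  assumes "finite G" "\<And>g. g \<in> G \<Longrightarrow> holomorphic_uhp g"
    and "\<And>j. j < card G \<Longrightarrow> holomorphic_uhp (d j)"
    and root: "\<And>g. g \<in> G \<Longrightarrow> (\<Sum>j<card G. d j * g ^ j) = 0"
    and "j < card G"
  shows "d j = 0"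
proof -
  define S where "S = {(g, h). g \<in> G \<and> h \<in> G \<and> g \<noteq> h}"
  define P where "P = (\<Prod>(g, h)\<in>S. g - h)"
  have "finite S"
    by (rule finite_subset[of _ "G \<times> G"]) (use assms(1) in \<open>auto simp: S_def\<close>)
  have hol: "holomorphic_uhp (case x of (g, h) \<Rightarrow> g - h)" if "x \<in> S" for x
    using that assms(2) by (auto simp: S_def intro: holomorphic_uhp_diff)
  have "P \<noteq> 0"
    unfolding P_def using \<open>finite S\<close> hol
    by (intro holomorphic_uhp_prod_nonzero) (auto simp: S_def)
  have "holomorphic_uhp P"
    unfolding P_def by (intro holomorphic_uhp_prod hol)
  have "d j \<tau> = 0" if nz: "P \<tau> \<noteq> 0" for \<tau>
  proof -
    have inj: "inj_on (\<lambda>g. g \<tau>) G"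
    proof (rule inj_onI, rule ccontr)
      fix g h assume "g \<in> G" "h \<in> G" "g \<tau> = h \<tau>" "g \<noteq> h"
      hence "(g, h) \<in> S" by (simp add: S_def)
      have "P \<tau> = (\<Prod>x\<in>S. (case x of (g, h) \<Rightarrow> g - h) \<tau>)"
        unfolding P_def by (rule fun_prod_apply)
      also have "\<dots> = 0"
        using \<open>finite S\<close> \<open>(g, h) \<in> S\<close> \<open>g \<tau> = h \<tau>\<close> by (intro prod_zero) (auto intro!: bexI[of _ "(g, h)"])
      finally show False using nz by simp
    qed
    define p where "p = (\<Sum>j<card G. monom (d j \<tau>) j)"
    have "p = 0"
    proof (rule ccontr)
      assume "p \<noteq> 0"
      have "poly p (g \<tau>) = 0" if "g \<in> G" for g
      proof -
        have "poly p (g \<tau>) = (\<Sum>j<card G. d j * g ^ j) \<tau>"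
          by (simp add: p_def poly_sum poly_monom fun_sum_apply fun_power_apply)
        thus ?thesis using root[OF that] by simp
      qed
      hence "(\<lambda>g. g \<tau>) ` G \<subseteq> {x. poly p x = 0}" by auto
      hence "card ((\<lambda>g. g \<tau>) ` G) \<le> card {x. poly p x = 0}"
        by (intro card_mono poly_roots_finite \<open>p \<noteq> 0\<close>)
      hence "card G \<le> degree p"
        using card_image[OF inj] card_poly_roots_bound[OF \<open>p \<noteq> 0\<close>] by simp
      moreover have "degree p < card G"
        unfolding p_def using assms(5)
        by (intro degree_sum_less) (auto intro: le_less_trans[OF degree_monom_le])
      ultimately show False by simp
    qed
    moreover have "coeff p j = d j \<tau>"
      using assms(5) by (simp add: p_def coeff_sum)
    ultimately show ?thesis by simp
  qed
  hence "(P * d j) \<tau> = 0 \<tau>" for \<tau> by (cases "P \<tau> = 0") auto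
  hence "P * d j = 0" by (rule ext)
  with \<open>holomorphic_uhp P\<close> assms(3)[OF assms(5)] show ?thesis
    using \<open>P \<noteq> 0\<close> by (rule holomorphic_uhp_no_zero_divisors)
qed


section \<open>Spaces of modular forms\<close>

lemma det_SL2Z: "M \<in> SL2Z \<Longrightarrow> det M = 1"
  by (simp add: SL2Z_def)

lemma modular_forms_iff:
  "f \<in> modular_forms \<kappa> \<Gamma> \<longleftrightarrow> holomorphic_uhp f \<and> (\<forall>\<gamma>\<in>\<Gamma>. slash \<kappa> f \<gamma> = f) \<and>
    (\<forall>\<gamma>\<in>SL2Z. \<exists>N a. has_q_expansion (slash \<kappa> f \<gamma>) N a)"
  by (simp add: modular_forms_def holomorphic_uhp_def)

text \<open>
  With the empty set of transformations only holomorphy on the half plane and at the cusps remains.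
  All conjugates of a form under rational matrices lie in these spaces, whatever their level.
\<close>

lemma modular_forms_empty_iff:
  "f \<in> modular_forms \<kappa> {} \<longleftrightarrow> holomorphic_uhp f \<and> (\<forall>\<gamma>\<in>SL2Z. \<exists>N a. has_q_expansion (slash \<kappa> f \<gamma>) N a)"
  by (simp add: modular_forms_iff)

lemma modular_forms_split:
  "f \<in> modular_forms \<kappa> \<Gamma> \<longleftrightarrow> f \<in> modular_forms \<kappa> {} \<and> (\<forall>\<gamma>\<in>\<Gamma>. slash \<kappa> f \<gamma> = f)"
  by (auto simp: modular_forms_iff)

lemma modular_forms_holomorphic: "f \<in> modular_forms \<kappa> \<Gamma> \<Longrightarrow> holomorphic_uhp f"
  by (simp add: modular_forms_iff)

lemma modular_forms_add:
  assumes "f \<in> modular_forms \<kappa> \<Gamma>" "g \<in> modular_forms \<kappa> \<Gamma>"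
  shows "f + g \<in> modular_forms \<kappa> \<Gamma>"
  unfolding modular_forms_iff
proof (intro conjI ballI)
  fix \<gamma> assume "\<gamma> \<in> SL2Z"
  then obtain N u M v where "has_q_expansion (slash \<kappa> f \<gamma>) N u" "has_q_expansion (slash \<kappa> g \<gamma>) M v"
    using assms by (meson modular_forms_iff)
  from has_q_expansion_add[OF has_q_expansion_common[OF this]]
  show "\<exists>N a. has_q_expansion (slash \<kappa> (f + g) \<gamma>) N a"
    unfolding slash_add by blast
qed (use assms in \<open>auto simp: modular_forms_iff slash_add intro: holomorphic_uhp_add\<close>)

lemma modular_forms_mult:
  assumes "f \<in> modular_forms \<kappa> \<Gamma>" "g \<in> modular_forms \<kappa>' \<Gamma>"
  shows "f * g \<in> modular_forms (\<kappa> + \<kappa>') \<Gamma>"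
  unfolding modular_forms_iff
proof (intro conjI ballI)
  fix \<gamma> assume "\<gamma> \<in> SL2Z"
  then obtain N u M v where "has_q_expansion (slash \<kappa> f \<gamma>) N u" "has_q_expansion (slash \<kappa>' g \<gamma>) M v"
    using assms by (meson modular_forms_iff)
  from has_q_expansion_mult[OF has_q_expansion_common[OF this]]
  show "\<exists>N a. has_q_expansion (slash (\<kappa> + \<kappa>') (f * g) \<gamma>) N a"
    unfolding slash_mult by blast
qed (use assms in \<open>auto simp: modular_forms_iff slash_mult intro: holomorphic_uhp_mult\<close>)

lemma modular_forms_const [simp]: "(\<lambda>_. c) \<in> modular_forms 0 \<Gamma>"
  unfolding modular_forms_iff using has_q_expansion_const by auto

lemma modular_forms_one [simp]: "1 \<in> modular_forms 0 \<Gamma>"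
  using modular_forms_const[of 1] by (simp add: one_fun_def)

lemma modular_forms_scale:
  assumes "f \<in> modular_forms \<kappa> \<Gamma>"
  shows "fun_scale c f \<in> modular_forms \<kappa> \<Gamma>"
  using modular_forms_mult[OF modular_forms_const assms] by (simp add: fun_scale_eq_mult)

lemma modular_forms_uminus: "f \<in> modular_forms \<kappa> \<Gamma> \<Longrightarrow> - f \<in> modular_forms \<kappa> \<Gamma>"
  using modular_forms_scale[of f \<kappa> \<Gamma> "-1"] by (simp add: fun_scale_def fun_Compl_def)

lemma modular_forms_diff:
  assumes "f \<in> modular_forms \<kappa> \<Gamma>" "g \<in> modular_forms \<kappa> \<Gamma>"
  shows "f - g \<in> modular_forms \<kappa> \<Gamma>"
  using modular_forms_add[OF assms(1) modular_forms_uminus[OF assms(2)]] by simp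

lemma modular_forms_zero [simp]: "0 \<in> modular_forms \<kappa> \<Gamma>"
proof -
  have "has_q_expansion 0 1 (\<lambda>_. 0)"
    by (simp add: has_q_expansion_iff)
  thus ?thesis by (auto simp: modular_forms_iff holomorphic_uhp_def)
qed

lemma modular_forms_sum:
  assumes "\<And>i. i \<in> A \<Longrightarrow> f i \<in> modular_forms \<kappa> \<Gamma>"
  shows "(\<Sum>i\<in>A. f i) \<in> modular_forms \<kappa> \<Gamma>"
  using assms
proof (induction A rule: infinite_finite_induct)
  case (insert x A)
  hence "f x + sum f A \<in> modular_forms \<kappa> \<Gamma>" by (intro modular_forms_add) auto
  thus ?case unfolding sum.insert[OF insert.hyps] .
qed simp_all

lemma modular_forms_power:
  assumes "f \<in> modular_forms \<kappa> \<Gamma>"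
  shows "f ^ n \<in> modular_forms (n * \<kappa>) \<Gamma>"
proof (induction n)
  case 0
  show ?case by simp
next
  case (Suc n)
  from modular_forms_mult[OF assms this] show ?case
    unfolding power_Suc mult_Suc .
qed

lemma modular_forms_prod:
  assumes "\<And>i. i \<in> A \<Longrightarrow> f i \<in> modular_forms (\<kappa> i) \<Gamma>"
  shows "(\<Prod>i\<in>A. f i) \<in> modular_forms (\<Sum>i\<in>A. \<kappa> i) \<Gamma>"
  using assms
proof (induction A rule: infinite_finite_induct)
  case (insert x A)
  hence "f x * prod f A \<in> modular_forms (\<kappa> x + sum \<kappa> A) \<Gamma>" by (intro modular_forms_mult) auto
  thus ?case unfolding sum.insert[OF insert.hyps] prod.insert[OF insert.hyps] .
qed simp_all


section \<open>Rational matrices preserve holomorphy at the cusps\<close>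

lemma mat2_eq_iff:
  fixes A B :: mat2
  shows "A = B \<longleftrightarrow> A $ 1 $ 1 = B $ 1 $ 1 \<and> A $ 1 $ 2 = B $ 1 $ 2 \<and> A $ 2 $ 1 = B $ 2 $ 1 \<and> A $ 2 $ 2 = B $ 2 $ 2"
  by (auto simp: vec_eq_iff forall_2)

definition mat2_of :: "rat \<Rightarrow> rat \<Rightarrow> rat \<Rightarrow> rat \<Rightarrow> mat2"
  where "mat2_of a b c d = vector [vector [a, b], vector [c, d]]"

lemma mat2_of_nth [simp]:
  "mat2_of a b c d $ 1 $ 1 = a" "mat2_of a b c d $ 1 $ 2 = b"
  "mat2_of a b c d $ 2 $ 1 = c" "mat2_of a b c d $ 2 $ 2 = d"
  by (simp_all add: mat2_of_def)

text \<open>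
  A Bezout relation between the entries of the first column gives a matrix of \<open>SL(2,\<int>)\<close> that clears
  the lower left entry, as in the Hermite normal form.
\<close>

lemma SL2Z_times_upper_triangular:
  fixes M :: mat2
  assumes "det M \<noteq> 0"
  obtains S T where "S \<in> SL2Z" "M = S ** T" "T $ 2 $ 1 = 0"
proof -
  obtain p s where ps: "M $ 1 $ 1 = of_int p / of_int s" "s > 0"
    by (metis Fract_of_int_quotient Rat_cases)
  obtain q t where qt: "M $ 2 $ 1 = of_int q / of_int t" "t > 0"
    by (metis Fract_of_int_quotient Rat_cases)
  define x y where "x = p * t" and "y = q * s"
  have "x \<noteq> 0 \<or> y \<noteq> 0"
  proof (rule ccontr)
    assume "\<not> (x \<noteq> 0 \<or> y \<noteq> 0)"
    hence "M $ 1 $ 1 = 0" "M $ 2 $ 1 = 0" using ps qt by (auto simp: x_def y_def)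
    thus False using assms by (simp add: det_2)
  qed
  define g where "g = gcd x y"
  have "g \<noteq> 0" using \<open>x \<noteq> 0 \<or> y \<noteq> 0\<close> by (simp add: g_def)
  obtain x' y' where xy': "x = g * x'" "y = g * y'"
    by (metis dvdE g_def gcd_dvd1 gcd_dvd2)
  obtain u v where uv_g: "u * x + v * y = g"
    using bezout_int[of x y] by (auto simp: g_def)
  have "g * (u * x' + v * y') = u * x + v * y"
    unfolding xy' by (simp only: distrib_left mult.left_commute)
  hence "g * (u * x' + v * y') = g * 1"
    by (simp only: uv_g mult_1_right)
  hence uv: "u * x' + v * y' = 1" using \<open>g \<noteq> 0\<close> mult_left_cancel by blast
  have uv_rat: "of_int u * of_int x' + of_int v * of_int y' = (1 :: rat)"
    using arg_cong[OF uv, of "of_int :: int \<Rightarrow> rat"] by simp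
  define S where "S = mat2_of (of_int x') (- of_int v) (of_int y') (of_int u)"
  define R where "R = mat2_of (of_int u) (of_int v) (- of_int y') (of_int x')"
  have "det S = 1"
    using uv_rat by (simp add: S_def det_2 mult.commute)
  hence "S \<in> SL2Z"
    by (simp add: SL2Z_def S_def forall_2)
  moreover have "S ** R = mat 1"
    using uv_rat by (simp add: mat2_eq_iff mat2_mult_nth S_def R_def mat_def mult.commute add.commute)
  hence "M = S ** (R ** M)" by (simp add: matrix_mul_assoc)
  moreover have "(R ** M) $ 2 $ 1 = 0"
  proof -
    have M: "M $ 1 $ 1 = of_int x / of_int (s * t)" "M $ 2 $ 1 = of_int y / of_int (s * t)"
      using ps qt by (simp_all add: x_def y_def)
    show ?thesis
      by (simp add: mat2_mult_nth R_def M xy')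
  qed
  ultimately show ?thesis using that by blast
qed

lemma has_q_expansion_upper_triangular:
  assumes "has_q_expansion f N u" "det T > 0" "T $ 2 $ 1 = 0"
  shows "\<exists>N u. has_q_expansion (slash \<kappa> f T) N u"
proof -
  define a b d where "a = T $ 1 $ 1" and "b = T $ 1 $ 2" and "d = T $ 2 $ 2"
  have ad: "a * d > 0" using assms(2,3) by (simp add: det_2 a_def d_def)
  hence d: "d \<noteq> 0" by auto
  have N: "N \<ge> 1" using assms(1) by (simp add: has_q_expansion_iff)
  have "a / d > 0" using ad by (simp add: zero_less_divide_iff zero_less_mult_iff)
  then obtain p q :: nat where pq: "a / d = of_nat p / of_nat q" "p \<ge> 1" "q \<ge> 1"
  proof -
    obtain i j where ij: "a / d = of_int i / of_int j" "j > 0"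
      by (metis Fract_of_int_quotient Rat_cases)
    hence "i > 0" using \<open>a / d > 0\<close> by (simp add: zero_less_divide_iff)
    show thesis
      by (rule that[of "nat i" "nat j"]) (use ij \<open>i > 0\<close> in auto)
  qed
  define \<zeta> where "\<zeta> = exp (2 * of_real pi * \<i> * of_rat (b / d) / of_nat N)"
  \<comment> \<open>The substitution \<open>\<tau> \<mapsto> (a\<tau> + b)/d\<close> turns \<open>q\<^bsup>1/N\<^esup>\<close> into a root of unity times \<open>q\<^bsup>p/(qN)\<^esup>\<close>.\<close>
  have root: "q_root N (moebius T \<tau>) = \<zeta> * q_root (N * q) \<tau> ^ p" for \<tau>
  proof -
    have "of_uhp (moebius T \<tau>) = of_rat (a / d) * of_uhp \<tau> + of_rat (b / d)"
      unfolding of_uhp_moebius[OF assms(2)]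
      by (simp add: automorphy_def assms(3) a_def b_def d_def of_rat_divide add_divide_distrib)
    also have "(of_rat (a / d) :: complex) = of_nat p / of_nat q"
      unfolding pq(1) by (simp add: of_rat_divide)
    finally have moeb: "of_uhp (moebius T \<tau>) = of_nat p / of_nat q * of_uhp \<tau> + of_rat (b / d)" .
    have alg: "c * (P / Q * w + \<beta>) / M = c * \<beta> / M + P * (c * w / (M * Q))" for c P Q w \<beta> M :: complex
      by (simp only: divide_inverse inverse_mult_distrib distrib_left distrib_right mult_ac add_ac)
    have eq: "2 * of_real pi * \<i> * of_uhp (moebius T \<tau>) / of_nat N =
        2 * of_real pi * \<i> * of_rat (b / d) / of_nat N +
        of_nat p * (2 * of_real pi * \<i> * of_uhp \<tau> / of_nat (N * q))"
      unfolding moeb of_nat_mult by (rule alg)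
    show ?thesis
      unfolding q_root_def[of N] eq exp_add exp_of_nat_mult \<zeta>_def q_root_def by (rule refl)
  qed
  define v where "v = spread_coeffs p (\<lambda>n. u n * \<zeta> ^ n / of_rat d ^ \<kappa>)"
  have "(\<lambda>n. v n * q_root (N * q) \<tau> ^ n) sums slash \<kappa> f T \<tau>" for \<tau>
  proof -
    have "(\<lambda>n. u n * q_root N (moebius T \<tau>) ^ n) sums f (moebius T \<tau>)"
      using assms(1) by (simp add: has_q_expansion_iff)
    hence "(\<lambda>n. u n * q_root N (moebius T \<tau>) ^ n / of_rat d ^ \<kappa>) sums (f (moebius T \<tau>) / of_rat d ^ \<kappa>)"
      by (rule sums_divide)
    moreover have "u n * q_root N (moebius T \<tau>) ^ n / of_rat d ^ \<kappa> =
        u n * \<zeta> ^ n / of_rat d ^ \<kappa> * (q_root (N * q) \<tau> ^ p) ^ n" for n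
      by (simp add: root power_mult_distrib)
    moreover have "f (moebius T \<tau>) / of_rat d ^ \<kappa> = slash \<kappa> f T \<tau>"
      by (simp add: slash_def automorphy_def assms(3) d_def)
    ultimately show ?thesis
      unfolding v_def spread_coeffs_sums[OF pq(2)] by (simp only:)
  qed
  hence "has_q_expansion (slash \<kappa> f T) (N * q) v"
    using N pq(3) by (simp add: has_q_expansion_iff)
  thus ?thesis by blast
qed

text \<open>
  If \<open>M\<gamma> = ST\<close> with \<open>S \<in> SL(2,\<int>)\<close> and \<open>T\<close> upper triangular, then the expansion of \<open>f|M\<gamma>\<close> arises from
  that of \<open>f|S\<close> by a substitution \<open>\<tau> \<mapsto> (a\<tau> + b)/d\<close>.
\<close>

lemma modular_forms_empty_slash:
  assumes "f \<in> modular_forms \<kappa> {}" "det M > 0"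
  shows "slash \<kappa> f M \<in> modular_forms \<kappa> {}"
  unfolding modular_forms_empty_iff
proof (intro conjI ballI)
  show "holomorphic_uhp (slash \<kappa> f M)"
    using assms by (simp add: modular_forms_empty_iff holomorphic_uhp_slash)
  fix \<gamma> assume "\<gamma> \<in> SL2Z"
  hence det: "det (M ** \<gamma>) > 0" "det \<gamma> > 0"
    using assms(2) by (simp_all add: det_mul det_SL2Z)
  then obtain S T where ST: "S \<in> SL2Z" "M ** \<gamma> = S ** T" "T $ 2 $ 1 = 0"
    using SL2Z_times_upper_triangular[of "M ** \<gamma>"] by auto
  have detS: "det S = 1" using ST(1) by (rule det_SL2Z)
  hence detT: "det T > 0" using det(1) unfolding ST(2) by (simp add: det_mul)
  obtain N u where "has_q_expansion (slash \<kappa> f S) N u"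
    using assms(1) ST(1) unfolding modular_forms_empty_iff by blast
  from has_q_expansion_upper_triangular[OF this detT ST(3), of \<kappa>]
  show "\<exists>N u. has_q_expansion (slash \<kappa> (slash \<kappa> f M) \<gamma>) N u"
    using detS detT det assms(2) ST(2) by (simp add: slash_slash)
qed


section \<open>A linear retraction onto the coefficient field\<close>

locale coefficient_retraction =
  fixes L :: "complex set" and \<rho> :: "complex \<Rightarrow> complex"
  assumes subfield: "subfield_of_complex L"
    and retract_add: "\<rho> (x + y) = \<rho> x + \<rho> y"
    and retract_mult: "x \<in> L \<Longrightarrow> \<rho> (x * y) = x * \<rho> y"
    and retract_in: "\<rho> x \<in> L"
    and retract_id: "x \<in> L \<Longrightarrow> \<rho> x = x"

text \<open>
  The kernel is an \<open>L\<close>-subspace of \<open>\<complex>\<close> that is maximal among those that avoid 1; by maximality it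
  is a complement of \<open>L\<close>.
\<close>

lemma ex_coefficient_retraction:
  assumes "subfield_of_complex L"
  shows "\<exists>\<rho>. coefficient_retraction L \<rho>"
proof -
  note L = assms[unfolded subfield_of_complex_def]
  define \<A> where "\<A> = {H :: complex set. 0 \<in> H \<and> 1 \<notin> H \<and> (\<forall>x\<in>H. \<forall>y\<in>H. x + y \<in> H) \<and> (\<forall>l\<in>L. \<forall>x\<in>H. l * x \<in> H)}"
  have "\<exists>H\<in>\<A>. \<forall>X\<in>\<A>. H \<subseteq> X \<longrightarrow> X = H"
  proof (rule subset_Zorn_nonempty)
    have "{0} \<in> \<A>" by (simp add: \<A>_def)
    thus "\<A> \<noteq> {}" by blast
    fix \<C> assume C: "\<C> \<noteq> {}" "subset.chain \<A> \<C>"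
    hence sub: "\<C> \<subseteq> \<A>" by (simp add: subset.chain_def)
    have "\<exists>X\<in>\<C>. x \<in> X \<and> y \<in> X" if "x \<in> \<Union> \<C>" "y \<in> \<Union> \<C>" for x y
    proof -
      obtain X Y where "X \<in> \<C>" "Y \<in> \<C>" "x \<in> X" "y \<in> Y" using \<open>x \<in> \<Union> \<C>\<close> \<open>y \<in> \<Union> \<C>\<close> by blast
      moreover have "X \<subseteq> Y \<or> Y \<subseteq> X"
        using C(2) \<open>X \<in> \<C>\<close> \<open>Y \<in> \<C>\<close> by (meson subset_chain_def)
      ultimately show ?thesis by blast
    qed
    hence "x + y \<in> \<Union> \<C>" if "x \<in> \<Union> \<C>" "y \<in> \<Union> \<C>" for x y
      using that sub unfolding \<A>_def by blast
    moreover have "0 \<in> \<Union> \<C>" "1 \<notin> \<Union> \<C>"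
      using C(1) sub unfolding \<A>_def by blast+
    moreover have "l * x \<in> \<Union> \<C>" if "l \<in> L" "x \<in> \<Union> \<C>" for l x
      using that sub unfolding \<A>_def by blast
    ultimately show "\<Union> \<C> \<in> \<A>" by (simp add: \<A>_def)
  qed
  then obtain H where H: "H \<in> \<A>" and max: "\<And>X. X \<in> \<A> \<Longrightarrow> H \<subseteq> X \<Longrightarrow> X = H" by blast
  have H0: "0 \<in> H" and H1: "1 \<notin> H" and H_add: "\<And>x y. x \<in> H \<Longrightarrow> y \<in> H \<Longrightarrow> x + y \<in> H"
    and H_mult: "\<And>l x. l \<in> L \<Longrightarrow> x \<in> H \<Longrightarrow> l * x \<in> H"
    using H by (auto simp: \<A>_def)
  have L_uminus: "- l \<in> L" and L_inverse: "inverse l \<in> L" if "l \<in> L" for l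
    using L that by auto
  have L_add: "l + l' \<in> L" and L_mult: "l * l' \<in> L" if "l \<in> L" "l' \<in> L" for l l'
    using L that by auto
  have L01: "0 \<in> L" "1 \<in> L" using L by auto
  have H_diff: "x - y \<in> H" if "x \<in> H" "y \<in> H" for x y
    using H_add[OF that(1) H_mult[OF L_uminus[OF L01(2)] that(2)]] by simp
  have "\<exists>l\<in>L. x - l \<in> H" for x
  proof (cases "x \<in> H")
    case True
    thus ?thesis using L01 by (intro bexI[of _ 0]) auto
  next
    case False
    define X where "X = {h + l * x | h l. h \<in> H \<and> l \<in> L}"
    have "h \<in> X" if "h \<in> H" for h
      unfolding X_def using that L01(1) by force
    hence "H \<subseteq> X" by blast
    have "x \<in> X" unfolding X_def using H0 L01(2) by force
    hence "X \<notin> \<A>" using max \<open>H \<subseteq> X\<close> False by blast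
    moreover have "a + b \<in> X" if "a \<in> X" "b \<in> X" for a b
    proof -
      obtain h l h' l' where "a = h + l * x" "b = h' + l' * x" "h \<in> H" "h' \<in> H" "l \<in> L" "l' \<in> L"
        using \<open>a \<in> X\<close> \<open>b \<in> X\<close> unfolding X_def by blast
      moreover from this have "a + b = (h + h') + (l + l') * x"
        by (simp only: distrib_right add_ac)
      ultimately show ?thesis unfolding X_def using H_add L_add by blast
    qed
    moreover have "m * a \<in> X" if "m \<in> L" "a \<in> X" for m a
    proof -
      obtain h l where "a = h + l * x" "h \<in> H" "l \<in> L"
        using \<open>a \<in> X\<close> unfolding X_def by blast
      moreover from this have "m * a = m * h + (m * l) * x"
        by (simp only: distrib_left mult.assoc)
      ultimately show ?thesis unfolding X_def using H_mult L_mult \<open>m \<in> L\<close> by blast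
    qed
    moreover have "0 \<in> X" using \<open>H \<subseteq> X\<close> H0 by blast
    ultimately have "1 \<in> X" unfolding \<A>_def by blast
    then obtain h l where hl: "1 = h + l * x" "h \<in> H" "l \<in> L" unfolding X_def by blast
    have "l \<noteq> 0"
    proof
      assume "l = 0"
      hence "h = 1" using hl(1) by (metis add.right_neutral mult_zero_left)
      thus False using hl(2) H1 by blast
    qed
    have "x - inverse l = inverse l * (- 1 * h)"
    proof -
      have h: "h = 1 - l * x" by (simp only: eq_diff_eq hl(1) [symmetric])
      show ?thesis unfolding h using \<open>l \<noteq> 0\<close> by (simp add: right_diff_distrib mult.assoc [symmetric])
    qed
    moreover have "inverse l * (- 1 * h) \<in> H"
      by (intro H_mult L_inverse L_uminus L01 hl)
    ultimately show ?thesis using L_inverse[OF hl(3)] by metis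
  qed
  then obtain \<rho> where \<rho>: "\<And>x. \<rho> x \<in> L" "\<And>x. x - \<rho> x \<in> H" by metis
  have unique: "l = l'" if "l \<in> L" "l' \<in> L" "x - l \<in> H" "x - l' \<in> H" for x l l'
  proof (rule ccontr)
    assume "l \<noteq> l'"
    have "l' - l \<in> H" using H_diff[OF that(3,4)] by simp
    moreover have "inverse (l' - l) \<in> L"
      using L_inverse[OF L_add[OF that(2) L_uminus[OF that(1)]]] by simp
    ultimately have "inverse (l' - l) * (l' - l) \<in> H" by (intro H_mult)
    thus False using \<open>l \<noteq> l'\<close> H1 by simp
  qed
  have "coefficient_retraction L \<rho>"
  proof
    show "subfield_of_complex L" by fact
    show "\<rho> x \<in> L" for x by (rule \<rho>)
    show "\<rho> x = x" if "x \<in> L" for x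
      by (rule unique[of _ _ x]) (use that \<rho> H0 in auto)
    show "\<rho> (x + y) = \<rho> x + \<rho> y" for x y
    proof (rule unique[of _ _ "x + y"])
      show "x + y - (\<rho> x + \<rho> y) \<in> H"
        using H_add[OF \<rho>(2)[of x] \<rho>(2)[of y]] by (simp add: algebra_simps)
    qed (auto intro: L_add \<rho>)
    show "\<rho> (x * y) = x * \<rho> y" if "x \<in> L" for x y
    proof (rule unique[of _ _ "x * y"])
      show "x * y - x * \<rho> y \<in> H"
        using H_mult[OF that \<rho>(2)[of y]] by (simp add: algebra_simps)
    qed (auto intro: L_mult \<rho> that)
  qed
  thus ?thesis by blast
qed

context coefficient_retraction
begin

lemma in_L [simp]: "0 \<in> L" "1 \<in> L"
  and L_add: "x \<in> L \<Longrightarrow> y \<in> L \<Longrightarrow> x + y \<in> L"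
  and L_mult: "x \<in> L \<Longrightarrow> y \<in> L \<Longrightarrow> x * y \<in> L"
  and L_uminus: "x \<in> L \<Longrightarrow> - x \<in> L"
  using subfield unfolding subfield_of_complex_def by blast+

lemma L_of_nat: "of_nat n \<in> L"
  by (induction n) (auto intro: L_add)

lemma retract_zero [simp]: "\<rho> 0 = 0"
  by (rule retract_id) simp

lemma retract_sum: "\<rho> (\<Sum>i\<in>A. f i) = (\<Sum>i\<in>A. \<rho> (f i))"
  by (induction A rule: infinite_finite_induct) (simp_all add: retract_add)

text \<open>
  The graph of the map that applies \<open>\<rho>\<close> to every coefficient of a \<open>q\<close>-expansion. It is a relation
  and not a function because nothing bounds \<open>\<rho>\<close>, so that the new series may diverge.
\<close>

definition retracts_to :: "(upper_half_plane \<Rightarrow> complex) \<Rightarrow> (upper_half_plane \<Rightarrow> complex) \<Rightarrow> bool"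
  where "retracts_to f g \<longleftrightarrow> (\<exists>N u. has_q_expansion f N u \<and> has_q_expansion g N (\<rho> \<circ> u))"

lemma retract_spread_coeffs: "\<rho> \<circ> spread_coeffs k u = spread_coeffs k (\<rho> \<circ> u)"
  by (auto simp: spread_coeffs_def fun_eq_iff)

lemma retracts_to_unique:
  assumes "retracts_to f g" "retracts_to f h"
  shows "g = h"
proof -
  obtain N u M v where u: "has_q_expansion f N u" "has_q_expansion g N (\<rho> \<circ> u)"
    and v: "has_q_expansion f M v" "has_q_expansion h M (\<rho> \<circ> v)"
    using assms by (auto simp: retracts_to_def)
  have "spread_coeffs M u = spread_coeffs N v"
    using has_q_expansion_common[OF u(1) v(1)] has_q_expansion_unique by blast
  hence "spread_coeffs M (\<rho> \<circ> u) = spread_coeffs N (\<rho> \<circ> v)"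
    by (simp flip: retract_spread_coeffs)
  thus ?thesis
    using has_q_expansion_common[OF u(2) v(2)] has_q_expansion_fun_unique by metis
qed

lemma retracts_to_add:
  assumes "retracts_to f f'" "retracts_to g g'"
  shows "retracts_to (f + g) (f' + g')"
proof -
  obtain N u M v where u: "has_q_expansion f N u" "has_q_expansion f' N (\<rho> \<circ> u)"
    and v: "has_q_expansion g M v" "has_q_expansion g' M (\<rho> \<circ> v)"
    using assms by (auto simp: retracts_to_def)
  let ?w = "\<lambda>n. spread_coeffs M u n + spread_coeffs N v n"
  have eq: "\<rho> \<circ> ?w = (\<lambda>n. spread_coeffs M (\<rho> \<circ> u) n + spread_coeffs N (\<rho> \<circ> v) n)"
    by (auto simp: fun_eq_iff retract_add simp flip: retract_spread_coeffs)
  have "has_q_expansion (f + g) (N * M) ?w"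
    by (rule has_q_expansion_add[OF has_q_expansion_common[OF u(1) v(1)]])
  moreover have "has_q_expansion (f' + g') (N * M) (\<rho> \<circ> ?w)"
    unfolding eq by (rule has_q_expansion_add[OF has_q_expansion_common[OF u(2) v(2)]])
  ultimately show ?thesis
    unfolding retracts_to_def by blast
qed

text \<open>
  Expansions are unique, so a fixed point of the coefficientwise map has its coefficients in the
  image of \<open>\<rho>\<close>.
\<close>

lemma q_coeffs_in_iff: "q_coeffs_in L f \<longleftrightarrow> retracts_to f f"
proof
  assume "q_coeffs_in L f"
  then obtain N u where u: "has_q_expansion f N u" "\<And>n. u n \<in> L"
    by (auto simp: q_coeffs_in_def)
  have "\<rho> \<circ> u = u" using u(2) by (auto simp: retract_id)
  thus "retracts_to f f" using u(1) unfolding retracts_to_def by metis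
next
  assume "retracts_to f f"
  then obtain N u where u: "has_q_expansion f N u" "has_q_expansion f N (\<rho> \<circ> u)"
    by (auto simp: retracts_to_def)
  have "u n = \<rho> (u n)" for n
    using fun_cong[OF has_q_expansion_unique[OF u], of n] by simp
  hence "u n \<in> L" for n by (metis retract_in)
  thus "q_coeffs_in L f" using u(1) by (auto simp: q_coeffs_in_def)
qed

text \<open>
  The map \<open>\<rho>\<close> is not multiplicative, but it commutes with Cauchy products in which one factor has
  its coefficients in \<open>L\<close>.
\<close>

lemma retracts_to_mult:
  assumes "retracts_to f f'" "q_coeffs_in L g"
  shows "retracts_to (f * g) (f' * g)"
proof -
  obtain N u where u: "has_q_expansion f N u" "has_q_expansion f' N (\<rho> \<circ> u)"
    using assms by (auto simp: retracts_to_def)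
  obtain M v where v: "has_q_expansion g M v" "\<And>n. v n \<in> L"
    using assms by (auto simp: q_coeffs_in_def)
  have v': "spread_coeffs N v n \<in> L" for n using v(2) by (simp add: spread_coeffs_def)
  let ?w = "\<lambda>n. \<Sum>i\<le>n. spread_coeffs M u i * spread_coeffs N v (n - i)"
  have "\<rho> (x * y) = \<rho> x * y" if "y \<in> L" for x y
    using retract_mult[OF that, of x] by (simp add: mult.commute)
  hence eq: "\<rho> \<circ> ?w = (\<lambda>n. \<Sum>i\<le>n. spread_coeffs M (\<rho> \<circ> u) i * spread_coeffs N v (n - i))"
    using v' by (simp add: fun_eq_iff retract_sum flip: retract_spread_coeffs)
  have "has_q_expansion (f * g) (N * M) ?w"
    by (rule has_q_expansion_mult[OF has_q_expansion_common[OF u(1) v(1)]])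
  moreover have "has_q_expansion (f' * g) (N * M) (\<rho> \<circ> ?w)"
    unfolding eq by (rule has_q_expansion_mult[OF has_q_expansion_common[OF u(2) v(1)]])
  ultimately show ?thesis
    unfolding retracts_to_def by blast
qed

lemma retracts_to_const: "retracts_to (\<lambda>_. c) (\<lambda>_. \<rho> c)"
proof -
  have eq: "\<rho> \<circ> (\<lambda>n. if n = 0 then c else 0) = (\<lambda>n :: nat. if n = 0 then \<rho> c else 0)"
    by auto
  have "has_q_expansion (\<lambda>_. \<rho> c) 1 (\<rho> \<circ> (\<lambda>n. if n = 0 then c else 0))"
    unfolding eq by (rule has_q_expansion_const)
  thus ?thesis unfolding retracts_to_def using has_q_expansion_const by blast
qed

lemma q_coeffs_in_const: "c \<in> L \<Longrightarrow> q_coeffs_in L (\<lambda>_. c)"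
  using retracts_to_const[of c] by (simp add: q_coeffs_in_iff retract_id)

lemma q_coeffs_in_zero: "q_coeffs_in L 0"
  using q_coeffs_in_const[of 0] by (simp add: zero_fun_def)

lemma q_coeffs_in_one: "q_coeffs_in L 1"
  using q_coeffs_in_const[of 1] by (simp add: one_fun_def)

lemma q_coeffs_in_add: "q_coeffs_in L f \<Longrightarrow> q_coeffs_in L g \<Longrightarrow> q_coeffs_in L (f + g)"
  unfolding q_coeffs_in_iff by (rule retracts_to_add)

lemma q_coeffs_in_mult: "q_coeffs_in L f \<Longrightarrow> q_coeffs_in L g \<Longrightarrow> q_coeffs_in L (f * g)"
  using retracts_to_mult[of f f g] by (simp add: q_coeffs_in_iff)

lemma q_coeffs_in_scale: "c \<in> L \<Longrightarrow> q_coeffs_in L f \<Longrightarrow> q_coeffs_in L (fun_scale c f)"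
  unfolding fun_scale_eq_mult by (intro q_coeffs_in_mult q_coeffs_in_const)

lemma retracts_to_sum:
  assumes "\<And>i. i \<in> A \<Longrightarrow> retracts_to (f i) (g i)"
  shows "retracts_to (\<Sum>i\<in>A. f i) (\<Sum>i\<in>A. g i)"
  using assms
proof (induction A rule: infinite_finite_induct)
  case (insert x A)
  hence "retracts_to (f x + sum f A) (g x + sum g A)" by (intro retracts_to_add) auto
  thus ?case unfolding sum.insert[OF insert.hyps] .
qed (use q_coeffs_in_zero in \<open>simp_all add: q_coeffs_in_iff\<close>)

lemma q_coeffs_in_power:
  assumes "q_coeffs_in L f"
  shows "q_coeffs_in L (f ^ n)"
proof (induction n)
  case 0
  show ?case unfolding power_0 by (rule q_coeffs_in_one)
next
  case (Suc n)
  from q_coeffs_in_mult[OF assms this] show ?case unfolding power_Suc .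
qed

lemma q_coeffs_in_prod:
  assumes "\<And>i. i \<in> A \<Longrightarrow> q_coeffs_in L (f i)"
  shows "q_coeffs_in L (\<Prod>i\<in>A. f i)"
  using assms
proof (induction A rule: infinite_finite_induct)
  case (insert x A)
  hence "q_coeffs_in L (f x * prod f A)" by (intro q_coeffs_in_mult) auto
  thus ?case unfolding prod.insert[OF insert.hyps] .
next
  case empty
  show ?case unfolding prod.empty by (rule q_coeffs_in_one)
next
  case (infinite A)
  show ?case unfolding prod.infinite[OF infinite.hyps] by (rule q_coeffs_in_one)
qed

end


section \<open>The characteristic polynomial of a finite set of forms\<close>

definition char_poly :: "(upper_half_plane \<Rightarrow> complex) set \<Rightarrow> (upper_half_plane \<Rightarrow> complex) poly"
  where "char_poly G = (\<Prod>g\<in>G. [:- g, 1:])"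

text \<open>
  The roots of \<open>p\<close> have weight \<open>\<kappa>\<close>, and \<open>p\<close> is homogeneous of weight \<open>n * \<kappa>\<close> when the variable also
  gets the weight \<open>\<kappa>\<close>.
\<close>

definition homogeneous_monic :: "nat \<Rightarrow> nat \<Rightarrow> (upper_half_plane \<Rightarrow> complex) poly \<Rightarrow> bool"
  where "homogeneous_monic \<kappa> n p \<longleftrightarrow>
    degree p \<le> n \<and> coeff p n = 1 \<and> (\<forall>j\<le>n. coeff p j \<in> modular_forms ((n - j) * \<kappa>) {})"

text \<open>
  The matrix \<open>M\<close> carries each coefficient of \<open>p\<close>, with its own weight, to that of \<open>q\<close>.
\<close>

definition slash_related ::
    "nat \<Rightarrow> nat \<Rightarrow> mat2 \<Rightarrow> (upper_half_plane \<Rightarrow> complex) poly \<Rightarrow> (upper_half_plane \<Rightarrow> complex) poly \<Rightarrow> bool"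
  where "slash_related \<kappa> n M p q \<longleftrightarrow> (\<forall>j\<le>n. slash ((n - j) * \<kappa>) (coeff p j) M = coeff q j)"

lemma coeff_linear_factor_mult:
  fixes g :: "'a::comm_ring_1"
  shows "coeff ([:- g, 1:] * p) 0 = - g * coeff p 0"
    and "coeff ([:- g, 1:] * p) (Suc j) = - g * coeff p (Suc j) + coeff p j"
  by simp_all

lemma linear_factor_weights:
  assumes "Suc j \<le> n"
  shows "(Suc n - Suc j) * \<kappa> = \<kappa> + (n - Suc j) * \<kappa>"
proof -
  have "Suc n - Suc j = Suc (n - Suc j)" using assms by simp
  thus ?thesis by simp
qed

lemma homogeneous_monic_step:
  assumes p: "homogeneous_monic \<kappa> n p" and g: "g \<in> modular_forms \<kappa> {}"
  shows "homogeneous_monic \<kappa> (Suc n) ([:- g, 1:] * p)"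
proof -
  have deg: "coeff p (Suc n) = 0" and lead: "coeff p n = 1"
    using p by (auto simp: homogeneous_monic_def intro: coeff_eq_0)
  have coeffs: "coeff p j \<in> modular_forms ((n - j) * \<kappa>) {}" if "j \<le> n" for j
    using p that by (simp add: homogeneous_monic_def)
  have "degree ([:- g, 1:] * p) \<le> degree [:- g, 1:] + degree p"
    by (rule degree_mult_le)
  also have "\<dots> \<le> Suc n" using p by (simp add: homogeneous_monic_def)
  finally have "degree ([:- g, 1:] * p) \<le> Suc n" .
  moreover have "coeff ([:- g, 1:] * p) (Suc n) = 1"
    unfolding coeff_linear_factor_mult deg lead by (simp only: mult_zero_right add_0_left)
  moreover have "coeff ([:- g, 1:] * p) j \<in> modular_forms ((Suc n - j) * \<kappa>) {}" if j: "j \<le> Suc n" for j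
  proof (cases j)
    case 0
    have "- g * coeff p 0 \<in> modular_forms (\<kappa> + (n - 0) * \<kappa>) {}"
      by (intro modular_forms_mult modular_forms_uminus g coeffs) simp
    thus ?thesis unfolding 0 coeff_linear_factor_mult by simp
  next
    case (Suc i)
    have "- g * coeff p (Suc i) \<in> modular_forms ((Suc n - Suc i) * \<kappa>) {}"
    proof (cases "Suc i \<le> n")
      case True
      show ?thesis unfolding linear_factor_weights[OF True]
        by (intro modular_forms_mult modular_forms_uminus g coeffs True)
    next
      case False
      hence "i = n" using j Suc by simp
      thus ?thesis by (simp only: deg mult_zero_right modular_forms_zero)
    qed
    moreover have "coeff p i \<in> modular_forms ((Suc n - Suc i) * \<kappa>) {}"
      using coeffs[of i] j Suc by simp
    ultimately show ?thesis unfolding Suc coeff_linear_factor_mult by (rule modular_forms_add)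
  qed
  ultimately show ?thesis by (simp only: homogeneous_monic_def simp_thms) blast
qed

lemma slash_related_step:
  assumes pq: "slash_related \<kappa> n M p q" and p: "homogeneous_monic \<kappa> n p" and q: "homogeneous_monic \<kappa> n q"
  shows "slash_related \<kappa> (Suc n) M ([:- g, 1:] * p) ([:- slash \<kappa> g M, 1:] * q)"
  unfolding slash_related_def
proof (intro allI impI)
  have deg: "coeff p (Suc n) = 0" "coeff q (Suc n) = 0"
    using p q by (auto simp: homogeneous_monic_def intro: coeff_eq_0)
  have rel: "slash ((n - j) * \<kappa>) (coeff p j) M = coeff q j" if "j \<le> n" for j
    using pq that by (simp add: slash_related_def)
  fix j assume j: "j \<le> Suc n"
  show "slash ((Suc n - j) * \<kappa>) (coeff ([:- g, 1:] * p) j) M = coeff ([:- slash \<kappa> g M, 1:] * q) j"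
  proof (cases j)
    case 0
    have "slash (\<kappa> + (n - 0) * \<kappa>) (- g * coeff p 0) M = - slash \<kappa> g M * coeff q 0"
      unfolding slash_mult slash_uminus using rel[of 0] by simp
    thus ?thesis unfolding 0 coeff_linear_factor_mult by simp
  next
    case (Suc i)
    have "slash ((Suc n - Suc i) * \<kappa>) (- g * coeff p (Suc i)) M = - slash \<kappa> g M * coeff q (Suc i)"
    proof (cases "Suc i \<le> n")
      case True
      show ?thesis unfolding linear_factor_weights[OF True] slash_mult slash_uminus rel[OF True] ..
    next
      case False
      hence "i = n" using j Suc by simp
      thus ?thesis by (simp only: deg mult_zero_right slash_zero)
    qed
    moreover have "slash ((Suc n - Suc i) * \<kappa>) (coeff p i) M = coeff q i"
      using rel[of i] j Suc by simp
    ultimately show ?thesis unfolding Suc coeff_linear_factor_mult slash_add by (simp only:)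
  qed
qed

lemma homogeneous_monic_one: "homogeneous_monic \<kappa> 0 1"
  by (simp add: homogeneous_monic_def)

lemma homogeneous_monic_prod:
  assumes "finite G" "\<And>g. g \<in> G \<Longrightarrow> f g \<in> modular_forms \<kappa> {}"
  shows "homogeneous_monic \<kappa> (card G) (\<Prod>g\<in>G. [:- f g, 1:])"
  using assms
proof (induction G)
  case empty
  show ?case using homogeneous_monic_one by simp
next
  case (insert g G)
  have "homogeneous_monic \<kappa> (card G) (\<Prod>g\<in>G. [:- f g, 1:])"
    by (rule insert.IH) (use insert.prems in blast)
  hence "homogeneous_monic \<kappa> (Suc (card G)) ([:- f g, 1:] * (\<Prod>g\<in>G. [:- f g, 1:]))"
    by (rule homogeneous_monic_step) (use insert.prems in blast)
  thus ?case unfolding prod.insert[OF insert.hyps] card_insert_disjoint[OF insert.hyps] .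
qed

lemma homogeneous_monic_char_poly:
  assumes "finite G" "G \<subseteq> modular_forms \<kappa> {}"
  shows "homogeneous_monic \<kappa> (card G) (char_poly G)"
  unfolding char_poly_def using assms by (intro homogeneous_monic_prod) auto

lemma slash_related_prod:
  assumes "finite G" "G \<subseteq> modular_forms \<kappa> {}" "det M > 0"
  shows "slash_related \<kappa> (card G) M (\<Prod>g\<in>G. [:- g, 1:]) (\<Prod>g\<in>G. [:- slash \<kappa> g M, 1:])"
  using assms(1,2)
proof (induction G)
  case empty
  show ?case by (simp add: slash_related_def)
next
  case (insert g G)
  have G: "G \<subseteq> modular_forms \<kappa> {}" using insert.prems by blast
  have "slash_related \<kappa> (Suc (card G)) M ([:- g, 1:] * (\<Prod>g\<in>G. [:- g, 1:]))
      ([:- slash \<kappa> g M, 1:] * (\<Prod>g\<in>G. [:- slash \<kappa> g M, 1:]))"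
    using insert.hyps(1) G assms(3)
    by (intro slash_related_step insert.IH homogeneous_monic_prod) (auto intro: modular_forms_empty_slash)
  thus ?case unfolding prod.insert[OF insert.hyps] card_insert_disjoint[OF insert.hyps] .
qed

text \<open>
  The matrices in \<open>\<Gamma>\<close> permute the linear factors and so fix their product.
\<close>

lemma char_poly_coeff_modular:
  assumes G: "finite G" "G \<subseteq> modular_forms \<kappa> {}" and det: "\<And>\<delta>. \<delta> \<in> \<Gamma> \<Longrightarrow> det \<delta> > 0"
    and inj: "\<And>\<delta>. \<delta> \<in> \<Gamma> \<Longrightarrow> inj_on (\<lambda>g. slash \<kappa> g \<delta>) G"
    and image: "\<And>\<delta>. \<delta> \<in> \<Gamma> \<Longrightarrow> (\<lambda>g. slash \<kappa> g \<delta>) ` G = G"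
    and j: "j \<le> card G"
  shows "coeff (char_poly G) j \<in> modular_forms ((card G - j) * \<kappa>) \<Gamma>"
  unfolding modular_forms_split[of _ _ \<Gamma>]
proof (intro conjI ballI)
  show "coeff (char_poly G) j \<in> modular_forms ((card G - j) * \<kappa>) {}"
    using homogeneous_monic_char_poly[OF G] j by (simp add: homogeneous_monic_def)
  fix \<delta> assume \<delta>: "\<delta> \<in> \<Gamma>"
  have "(\<Prod>g\<in>G. [:- slash \<kappa> g \<delta>, 1:]) = (\<Prod>g\<in>(\<lambda>g. slash \<kappa> g \<delta>) ` G. [:- g, 1:])"
    unfolding prod.reindex[OF inj[OF \<delta>]] o_def ..
  hence "(\<Prod>g\<in>G. [:- slash \<kappa> g \<delta>, 1:]) = char_poly G"
    unfolding image[OF \<delta>] char_poly_def .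
  moreover have "slash_related \<kappa> (card G) \<delta> (char_poly G) (\<Prod>g\<in>G. [:- slash \<kappa> g \<delta>, 1:])"
    unfolding char_poly_def by (rule slash_related_prod[OF G det[OF \<delta>]])
  ultimately show "slash ((card G - j) * \<kappa>) (coeff (char_poly G) j) \<delta> = coeff (char_poly G) j"
    using j by (simp only: slash_related_def)
qed

lemma homogeneous_monic_eval:
  assumes "homogeneous_monic \<kappa> n p"
  shows "poly p x = (\<Sum>j\<le>n. coeff p j * x ^ j)"
proof -
  have "degree p \<le> n" using assms by (simp add: homogeneous_monic_def)
  thus ?thesis
    unfolding poly_altdef by (intro sum.mono_neutral_left) (auto simp: coeff_eq_0)
qed

lemma char_poly_root:
  assumes "finite G" "g \<in> G"
  shows "poly (char_poly G) g = 0"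
  unfolding char_poly_def poly_prod
  by (rule prod_zero) (use assms in \<open>auto intro!: bexI[of _ g]\<close>)

lemma char_poly_subleading:
  assumes "finite G" "G \<noteq> {}"
  shows "(\<Sum>g\<in>G. g) = - coeff (char_poly G) (card G - 1)"
proof
  fix \<tau>
  have "coeff (char_poly G) (card G) = 1 \<and> (\<forall>j. card G = Suc j \<longrightarrow> coeff (char_poly G) j \<tau> = - (\<Sum>g\<in>G. g \<tau>)) \<and>
      degree (char_poly G) \<le> card G"
    using assms(1)
  proof (induction G)
    case empty
    show ?case by (simp add: char_poly_def)
  next
    case (insert g G)
    let ?p = "char_poly G"
    have eq: "char_poly (insert g G) = [:- g, 1:] * ?p"
      unfolding char_poly_def prod.insert[OF insert.hyps] ..
    have IH: "coeff ?p (card G) = 1" "degree ?p \<le> card G"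
      "\<And>j. card G = Suc j \<Longrightarrow> coeff ?p j \<tau> = - (\<Sum>g\<in>G. g \<tau>)"
      using insert.IH by blast+
    have deg: "coeff ?p (Suc (card G)) = 0" using IH(2) by (intro coeff_eq_0) simp
    have "degree ([:- g, 1:] * ?p) \<le> degree [:- g, 1:] + degree ?p"
      by (rule degree_mult_le)
    also have "\<dots> \<le> Suc (card G)" using IH(2) by simp
    finally have "degree ([:- g, 1:] * ?p) \<le> Suc (card G)" .
    moreover have "coeff ([:- g, 1:] * ?p) (Suc (card G)) = 1"
      unfolding coeff_linear_factor_mult IH(1) deg by (simp only: mult_zero_right add_0_left)
    moreover have "coeff ([:- g, 1:] * ?p) (card G) \<tau> = - (\<Sum>h\<in>insert g G. h \<tau>)"
    proof (cases "card G")
      case 0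
      hence "G = {}" using insert.hyps(1) by simp
      thus ?thesis by (simp add: char_poly_def)
    next
      case (Suc i)
      have "coeff ([:- g, 1:] * ?p) (Suc i) \<tau> = - g \<tau> * coeff ?p (Suc i) \<tau> + coeff ?p i \<tau>"
        unfolding coeff_linear_factor_mult by simp
      also have "\<dots> = - (\<Sum>h\<in>insert g G. h \<tau>)"
        using IH(1) IH(3)[OF Suc] insert.hyps unfolding Suc by simp
      finally show ?thesis unfolding Suc .
    qed
    ultimately show ?case
      unfolding eq card_insert_disjoint[OF insert.hyps] by blast
  qed
  moreover have "card G = Suc (card G - 1)" using assms by (simp add: card_gt_0_iff)
  ultimately have "coeff (char_poly G) (card G - 1) \<tau> = - (\<Sum>g\<in>G. g \<tau>)" by blast
  thus "(\<Sum>g\<in>G. g) \<tau> = (- coeff (char_poly G) (card G - 1)) \<tau>"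
    by (simp add: fun_sum_apply)
qed


section \<open>Hecke operators preserve rationality\<close>

lemma matrix_inv_mult:
  fixes A :: mat2
  assumes "det A \<noteq> 0"
  shows "A ** matrix_inv A = mat 1" "matrix_inv A ** A = mat 1"
proof -
  have "\<exists>B. A ** B = mat 1 \<and> B ** A = mat 1"
    using assms invertible_det_nz[of A] by (simp add: invertible_def)
  hence "A ** matrix_inv A = mat 1 \<and> matrix_inv A ** A = mat 1"
    unfolding matrix_inv_def by (rule someI_ex)
  thus "A ** matrix_inv A = mat 1" "matrix_inv A ** A = mat 1" by blast+
qed

definition exponent_weight :: "('r::finite \<Rightarrow> nat) \<Rightarrow> ('r \<Rightarrow>\<^sub>0 nat) \<Rightarrow> nat"
  where "exponent_weight wt e = (\<Sum>i\<in>UNIV. Poly_Mapping.lookup e i * wt i)"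

definition monomial_form ::
    "('r::finite \<Rightarrow> upper_half_plane \<Rightarrow> complex) \<Rightarrow> ('r \<Rightarrow>\<^sub>0 nat) \<Rightarrow> upper_half_plane \<Rightarrow> complex"
  where "monomial_form a e = (\<Prod>i\<in>UNIV. a i ^ Poly_Mapping.lookup e i)"

lemma single_power:
  "Poly_Mapping.single k x ^ n = Poly_Mapping.single (n * k) (x ^ n)"
  for k :: nat and x :: "'a::comm_ring_1"
  by (induction n) (simp_all add: mult_single)

lemma single_prod:
  "finite A \<Longrightarrow> (\<Prod>i\<in>A. Poly_Mapping.single (k i) (x i)) = Poly_Mapping.single (\<Sum>i\<in>A. k i) (\<Prod>i\<in>A. x i)"
  for k :: "'i \<Rightarrow> 'k::comm_monoid_add" and x :: "'i \<Rightarrow> 'a::comm_ring_1"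
  by (induction A rule: finite_induct) (simp_all add: mult_single)

lemma prod_keys_eq_UNIV:
  "(\<Prod>i\<in>Poly_Mapping.keys e. x i ^ Poly_Mapping.lookup e i) = (\<Prod>i\<in>UNIV. x i ^ Poly_Mapping.lookup e i)"
  for e :: "'r::finite \<Rightarrow>\<^sub>0 nat" and x :: "'r \<Rightarrow> 'a::comm_ring_1"
  by (rule prod.mono_neutral_left) (auto simp: in_keys_iff)

lemma graded_monomial:
  "(\<Prod>i\<in>UNIV. Poly_Mapping.single (wt i) (a i) ^ Poly_Mapping.lookup e i) =
    Poly_Mapping.single (exponent_weight wt e) (monomial_form a e)"
  by (simp add: single_power single_prod exponent_weight_def monomial_form_def)

locale rational_generators = coefficient_retraction L \<rho>
  for L :: "complex set" and \<rho> :: "complex \<Rightarrow> complex" +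
  fixes \<Gamma> :: "mat2 set" and wt :: "'r::finite \<Rightarrow> nat" and a :: "'r \<Rightarrow> upper_half_plane \<Rightarrow> complex"
  assumes generator_modular: "\<And>i. a i \<in> modular_forms (wt i) \<Gamma>"
    and generator_rational: "\<And>i. q_coeffs_in L (a i)"
    and generators_span: "range (mpoly_eval graded_const (\<lambda>i. Poly_Mapping.single (wt i) (a i))) = graded_ring \<Gamma>"
begin

lemma monomial_modular: "monomial_form a e \<in> modular_forms (exponent_weight wt e) \<Gamma>"
  unfolding monomial_form_def exponent_weight_def
  by (intro modular_forms_prod modular_forms_power generator_modular)

lemma monomial_rational: "q_coeffs_in L (monomial_form a e)"
  unfolding monomial_form_def by (intro q_coeffs_in_prod q_coeffs_in_power generator_rational)

lemma modular_form_combination: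
  assumes f: "f \<in> modular_forms \<kappa> \<Gamma>"
  obtains T c where "finite T" "\<And>e. e \<in> T \<Longrightarrow> exponent_weight wt e = \<kappa>"
    "f = (\<Sum>e\<in>T. fun_scale (c e) (monomial_form a e))"
proof -
  have "Poly_Mapping.single \<kappa> f \<in> graded_ring \<Gamma>"
    using f by (auto simp: graded_ring_def lookup_single when_def)
  then obtain p :: "('r, complex) mpoly" where p: "mpoly_eval graded_const (\<lambda>i. Poly_Mapping.single (wt i) (a i)) p = Poly_Mapping.single \<kappa> f"
    unfolding generators_span[symmetric] by (metis imageE)
  define c where "c = Poly_Mapping.lookup p"
  define T where "T = {e \<in> Poly_Mapping.keys p. exponent_weight wt e = \<kappa>}"
  have term_eq: "graded_const x * (\<Prod>i\<in>Poly_Mapping.keys e. Poly_Mapping.single (wt i) (a i) ^ Poly_Mapping.lookup e i) =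
      Poly_Mapping.single (exponent_weight wt e) (fun_scale x (monomial_form a e))" for e x
    unfolding prod_keys_eq_UNIV graded_monomial graded_const_def mult_single
    by (simp add: fun_scale_eq_mult)
  have "Poly_Mapping.single \<kappa> f =
      (\<Sum>e\<in>Poly_Mapping.keys p. Poly_Mapping.single (exponent_weight wt e) (fun_scale (c e) (monomial_form a e)))"
    unfolding p[symmetric] mpoly_eval_def term_eq c_def ..
  hence "Poly_Mapping.lookup (Poly_Mapping.single \<kappa> f) \<kappa> =
      (\<Sum>e\<in>Poly_Mapping.keys p.
        Poly_Mapping.lookup (Poly_Mapping.single (exponent_weight wt e) (fun_scale (c e) (monomial_form a e))) \<kappa>)"
    by (simp only: lookup_sum)
  also have "\<dots> = (\<Sum>e\<in>T. fun_scale (c e) (monomial_form a e))"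
    unfolding T_def by (rule sum.mono_neutral_cong_right) (auto simp: lookup_single when_def)
  finally have "f = (\<Sum>e\<in>T. fun_scale (c e) (monomial_form a e))" by simp
  thus ?thesis by (intro that[of T c]) (simp_all add: T_def)
qed

lemma retracts_to_monomial:
  "retracts_to (fun_scale c (monomial_form a e)) (fun_scale (\<rho> c) (monomial_form a e))"
  unfolding fun_scale_eq_mult by (intro retracts_to_mult retracts_to_const monomial_rational)

text \<open>
  A form is a polynomial with complex coefficients in the generators. As the generators have their
  \<open>q\<close>-coefficients in \<open>L\<close>, it is enough to apply \<open>\<rho>\<close> to the coefficients of this polynomial.
\<close>

lemma modular_form_retract:
  assumes "f \<in> modular_forms \<kappa> \<Gamma>"
  shows "\<exists>g\<in>modular_forms \<kappa> \<Gamma>. retracts_to f g"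
proof -
  obtain T c where T: "finite T" "\<And>e. e \<in> T \<Longrightarrow> exponent_weight wt e = \<kappa>"
    and f: "f = (\<Sum>e\<in>T. fun_scale (c e) (monomial_form a e))"
    using modular_form_combination[OF assms] by blast
  have "retracts_to f (\<Sum>e\<in>T. fun_scale (\<rho> (c e)) (monomial_form a e))"
    unfolding f by (intro retracts_to_sum retracts_to_monomial)
  moreover have "fun_scale (\<rho> (c e)) (monomial_form a e) \<in> modular_forms \<kappa> \<Gamma>" if "e \<in> T" for e
    using modular_forms_scale[OF monomial_modular[of e]] unfolding T(2)[OF that] .
  hence "(\<Sum>e\<in>T. fun_scale (\<rho> (c e)) (monomial_form a e)) \<in> modular_forms \<kappa> \<Gamma>"
    by (rule modular_forms_sum)
  ultimately show ?thesis by blast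
qed

text \<open>
  The form is its own image under the retraction, which replaces the complex coefficients of any
  representing polynomial by elements of \<open>L\<close>.
\<close>

lemma rational_form_combination:
  assumes "f \<in> modular_forms \<kappa> \<Gamma>" "q_coeffs_in L f"
  obtains T c where "finite T" "\<And>e. e \<in> T \<Longrightarrow> exponent_weight wt e = \<kappa>" "\<And>e. c e \<in> L"
    "f = (\<Sum>e\<in>T. fun_scale (c e) (monomial_form a e))"
proof -
  obtain T c where T: "finite T" "\<And>e. e \<in> T \<Longrightarrow> exponent_weight wt e = \<kappa>"
    and f: "f = (\<Sum>e\<in>T. fun_scale (c e) (monomial_form a e))"
    using modular_form_combination[OF assms(1)] by blast
  have "retracts_to f (\<Sum>e\<in>T. fun_scale (\<rho> (c e)) (monomial_form a e))"
    unfolding f by (intro retracts_to_sum retracts_to_monomial)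
  moreover have "retracts_to f f" using assms(2) by (simp add: q_coeffs_in_iff)
  ultimately have "f = (\<Sum>e\<in>T. fun_scale (\<rho> (c e)) (monomial_form a e))"
    by (rule retracts_to_unique [symmetric])
  thus ?thesis using T by (intro that[of T "\<lambda>e. \<rho> (c e)"]) (simp_all add: retract_in)
qed

text \<open>
  The \<open>L\<close>-rational form \<open>f\<close> is a root of its characteristic polynomial and also of the image of this
  polynomial under the retraction. The coefficients of the second polynomial are invariant under
  \<open>\<Gamma>\<close>, so all conjugates of \<open>f\<close> are roots of it, and the two monic polynomials agree. In other
  words, the minimal polynomial of \<open>f\<close> over the modular functions for \<open>\<Gamma>\<close> has the same degree whether
  the constants are \<open>L\<close> or \<open>\<complex>\<close>.
\<close>

lemma char_poly_coeff_rational: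
  assumes G: "finite G" "G \<subseteq> modular_forms \<kappa> {}" and f: "f \<in> G" "q_coeffs_in L f"
    and conj: "\<And>g. g \<in> G \<Longrightarrow> \<exists>\<gamma>\<in>\<Gamma>. g = slash \<kappa> f \<gamma>"
    and modular: "\<And>j. j \<le> card G \<Longrightarrow> coeff (char_poly G) j \<in> modular_forms ((card G - j) * \<kappa>) \<Gamma>"
    and j: "j \<le> card G"
  shows "q_coeffs_in L (coeff (char_poly G) j)"
proof (cases "j = card G")
  case True
  have "coeff (char_poly G) (card G) = 1"
    using homogeneous_monic_char_poly[OF G] by (simp add: homogeneous_monic_def)
  thus ?thesis unfolding True by (simp only: q_coeffs_in_one)
next
  case False
  define n where "n = card G"
  define m where "m = coeff (char_poly G)"
  have mon: "homogeneous_monic \<kappa> n (char_poly G)"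
    unfolding n_def by (rule homogeneous_monic_char_poly[OF G])
  have m_modular: "m i \<in> modular_forms ((n - i) * \<kappa>) \<Gamma>" if "i < n" for i
    using modular[of i] that by (simp add: m_def n_def)
  have "\<exists>h. \<forall>i<n. h i \<in> modular_forms ((n - i) * \<kappa>) \<Gamma> \<and> retracts_to (m i) (h i)"
    using modular_form_retract[OF m_modular] by metis
  then obtain h where h: "\<And>i. i < n \<Longrightarrow> h i \<in> modular_forms ((n - i) * \<kappa>) \<Gamma>"
    "\<And>i. i < n \<Longrightarrow> retracts_to (m i) (h i)" by blast
  have "0 = (\<Sum>i\<le>n. m i * f ^ i)"
    using homogeneous_monic_eval[OF mon, of f] char_poly_root[OF G(1) f(1)] by (simp only: m_def)
  also have "\<dots> = (\<Sum>i<n. m i * f ^ i) + m n * f ^ n"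
    by (simp only: lessThan_Suc_atMost [symmetric] sum.lessThan_Suc)
  also have "m n = 1" using mon by (simp add: m_def homogeneous_monic_def)
  finally have sum_m: "(\<Sum>i<n. m i * f ^ i) = - (f ^ n)"
    by (simp only: mult_1_left eq_neg_iff_add_eq_0)
  have "q_coeffs_in L (- (f ^ n))"
    using q_coeffs_in_mult[OF q_coeffs_in_const[OF L_uminus[OF in_L(2)]] q_coeffs_in_power[OF f(2), of n]]
    by (simp add: times_fun_def fun_Compl_def)
  hence "retracts_to (\<Sum>i<n. m i * f ^ i) (- (f ^ n))"
    unfolding sum_m q_coeffs_in_iff .
  moreover have "retracts_to (\<Sum>i<n. m i * f ^ i) (\<Sum>i<n. h i * f ^ i)"
    by (intro retracts_to_sum retracts_to_mult q_coeffs_in_power f(2) h(2)) simp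
  ultimately have sum_h: "(\<Sum>i<n. h i * f ^ i) = - (f ^ n)"
    by (rule retracts_to_unique[OF _ _, symmetric])
  \<comment> \<open>The leading terms cancel, so the difference has too small a degree for its \<open>n\<close> roots.\<close>
  define d where "d = (\<lambda>i. m i - h i)"
  have sum_d: "(\<Sum>i<n. d i * f ^ i) = 0"
    unfolding d_def left_diff_distrib sum_subtractf sum_m sum_h by (rule diff_self)
  have d_modular: "d i \<in> modular_forms ((n - i) * \<kappa>) \<Gamma>" if "i < n" for i
    unfolding d_def using that by (intro modular_forms_diff m_modular h(1))
  have "d j = 0"
  proof (rule holomorphic_many_roots_imp_coeffs_zero[OF G(1)])
    show "holomorphic_uhp g" if "g \<in> G" for g
      using G(2) that by (auto intro: modular_forms_holomorphic)
    show "holomorphic_uhp (d i)" if "i < card G" for i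
      using d_modular that unfolding n_def by (blast intro: modular_forms_holomorphic)
    show "j < card G" using j False by simp
    fix g assume "g \<in> G"
    then obtain \<gamma> where \<gamma>: "\<gamma> \<in> \<Gamma>" "g = slash \<kappa> f \<gamma>" using conj by blast
    have "slash (n * \<kappa>) (d i * f ^ i) \<gamma> = d i * g ^ i" if "i < n" for i
    proof -
      have wt: "n * \<kappa> = (n - i) * \<kappa> + i * \<kappa>"
        using that by (simp flip: distrib_right)
      have "slash ((n - i) * \<kappa>) (d i) \<gamma> = d i"
        using d_modular[OF that] \<gamma>(1) by (simp add: modular_forms_iff)
      thus ?thesis unfolding wt slash_mult slash_power \<gamma>(2) by (simp only:)
    qed
    hence "(\<Sum>i<n. d i * g ^ i) = (\<Sum>i<n. slash (n * \<kappa>) (d i * f ^ i) \<gamma>)"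
      by (intro sum.cong refl) simp
    also have "\<dots> = slash (n * \<kappa>) (\<Sum>i<n. d i * f ^ i) \<gamma>"
      by (rule slash_sum [symmetric])
    finally have "(\<Sum>i<n. d i * g ^ i) = 0"
      unfolding sum_d slash_zero .
    thus "(\<Sum>i<card G. d i * g ^ i) = 0"
      unfolding n_def .
  qed
  hence "m j = h j" by (simp only: d_def eq_iff_diff_eq_0 [symmetric])
  moreover have "j < n" using j False by (simp add: n_def)
  ultimately have "retracts_to (m j) (m j)" using h(2) by metis
  thus ?thesis unfolding m_def q_coeffs_in_iff .
qed

end


text \<open>
  A sum over infinitely many cosets is 0 by convention, and the Hecke operator is then 0 as well.
  The locale describes the other case.
\<close>

locale rational_hecke = rational_generators L \<rho> \<Gamma> wt a
  for L :: "complex set" and \<rho> :: "complex \<Rightarrow> complex" and \<Gamma> :: "mat2 set"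
    and wt :: "'r::finite \<Rightarrow> nat" and a :: "'r \<Rightarrow> upper_half_plane \<Rightarrow> complex" +
  fixes \<alpha> :: mat2 and C :: complex
  assumes congruence: "congruence_subgroup \<Gamma>"
    and det_\<alpha>: "det \<alpha> > 0"
    and prime_rational: "\<And>\<kappa> f. f \<in> modular_forms \<kappa> \<Gamma> \<Longrightarrow> q_coeffs_in L f \<Longrightarrow> q_coeffs_in L (prime_form C \<alpha> \<kappa> f)"
    and finite_cosets: "finite (right_cosets (hecke_subgroup \<Gamma> \<alpha>) \<Gamma>)"
begin

abbreviation cosets :: "mat2 set set"
  where "cosets \<equiv> right_cosets (hecke_subgroup \<Gamma> \<alpha>) \<Gamma>"

definition conjugate_form :: "nat \<Rightarrow> (upper_half_plane \<Rightarrow> complex) \<Rightarrow> mat2 set \<Rightarrow> upper_half_plane \<Rightarrow> complex"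
  where "conjugate_form \<kappa> f K = slash \<kappa> (prime_form C \<alpha> \<kappa> f) (SOME \<gamma>. \<gamma> \<in> K)"

definition conjugates :: "nat \<Rightarrow> (upper_half_plane \<Rightarrow> complex) \<Rightarrow> (upper_half_plane \<Rightarrow> complex) set"
  where "conjugates \<kappa> f = conjugate_form \<kappa> f ` cosets"

lemma group_one: "mat 1 \<in> \<Gamma>"
  and group_mult: "A \<in> \<Gamma> \<Longrightarrow> B \<in> \<Gamma> \<Longrightarrow> A ** B \<in> \<Gamma>"
  and group_inv: "A \<in> \<Gamma> \<Longrightarrow> matrix_inv A \<in> \<Gamma>"
  and group_det: "A \<in> \<Gamma> \<Longrightarrow> det A = 1"
  using congruence det_SL2Z unfolding congruence_subgroup_def by blast+

lemma subgroup_subset: "\<delta> \<in> hecke_subgroup \<Gamma> \<alpha> \<Longrightarrow> \<delta> \<in> \<Gamma>"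
  by (simp add: hecke_subgroup_def)

lemma prime_form_slash_subgroup:
  assumes f: "f \<in> modular_forms \<kappa> \<Gamma>" and \<delta>: "\<delta> \<in> hecke_subgroup \<Gamma> \<alpha>"
  shows "slash \<kappa> (prime_form C \<alpha> \<kappa> f) \<delta> = prime_form C \<alpha> \<kappa> f"
proof -
  obtain \<gamma> where \<gamma>: "\<gamma> \<in> \<Gamma>" "\<delta> = matrix_inv \<alpha> ** \<gamma> ** \<alpha>"
    using \<delta> by (auto simp: hecke_subgroup_def)
  have "\<alpha> ** \<delta> = \<alpha> ** matrix_inv \<alpha> ** \<gamma> ** \<alpha>" unfolding \<gamma>(2) by (simp add: matrix_mul_assoc)
  hence "\<alpha> ** \<delta> = \<gamma> ** \<alpha>" using matrix_inv_mult(1)[of \<alpha>] det_\<alpha> by simp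
  moreover have "det \<delta> > 0" "det \<gamma> > 0"
    using group_det[OF subgroup_subset[OF \<delta>]] group_det[OF \<gamma>(1)] by simp_all
  ultimately have "slash \<kappa> (slash \<kappa> f \<alpha>) \<delta> = slash \<kappa> (slash \<kappa> f \<gamma>) \<alpha>"
    using det_\<alpha> by (simp add: slash_slash)
  also have "slash \<kappa> f \<gamma> = f" using f \<gamma>(1) by (simp add: modular_forms_iff)
  finally show ?thesis by (simp add: prime_form_def slash_scale)
qed

text \<open>
  The form \<open>f'\<close> is invariant under \<open>\<Gamma>'\<close>, so every representative of a coset gives the same conjugate.
\<close>

lemma conjugate_form_coset:
  assumes f: "f \<in> modular_forms \<kappa> \<Gamma>" and \<gamma>: "\<gamma> \<in> \<Gamma>"
  shows "conjugate_form \<kappa> f ((\<lambda>\<delta>. \<delta> ** \<gamma>) ` hecke_subgroup \<Gamma> \<alpha>) = slash \<kappa> (prime_form C \<alpha> \<kappa> f) \<gamma>"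
proof -
  let ?K = "(\<lambda>\<delta>. \<delta> ** \<gamma>) ` hecke_subgroup \<Gamma> \<alpha>"
  have "matrix_inv \<alpha> ** mat 1 ** \<alpha> = mat 1"
    using matrix_inv_mult(2)[of \<alpha>] det_\<alpha> by simp
  hence "mat 1 \<in> hecke_subgroup \<Gamma> \<alpha>"
    unfolding hecke_subgroup_def using group_one by force
  hence "\<exists>\<gamma>. \<gamma> \<in> ?K" by blast
  hence "(SOME \<gamma>. \<gamma> \<in> ?K) \<in> ?K" by (rule someI_ex)
  then obtain \<delta> where \<delta>: "\<delta> \<in> hecke_subgroup \<Gamma> \<alpha>" "(SOME \<gamma>. \<gamma> \<in> ?K) = \<delta> ** \<gamma>" by blast
  have "det \<delta> > 0" "det \<gamma> > 0"
    using group_det[OF subgroup_subset[OF \<delta>(1)]] group_det[OF \<gamma>] by simp_all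
  hence "slash \<kappa> (prime_form C \<alpha> \<kappa> f) (\<delta> ** \<gamma>) = slash \<kappa> (slash \<kappa> (prime_form C \<alpha> \<kappa> f) \<delta>) \<gamma>"
    by (simp add: slash_slash)
  thus ?thesis
    unfolding conjugate_form_def \<delta>(2) prime_form_slash_subgroup[OF f \<delta>(1)] .
qed

lemma conjugates_eq:
  assumes "f \<in> modular_forms \<kappa> \<Gamma>"
  shows "conjugates \<kappa> f = (\<lambda>\<gamma>. slash \<kappa> (prime_form C \<alpha> \<kappa> f) \<gamma>) ` \<Gamma>"
  unfolding conjugates_def right_cosets_def image_image
  by (rule image_cong) (simp_all add: conjugate_form_coset[OF assms])

lemma finite_conjugates: "finite (conjugates \<kappa> f)"
  unfolding conjugates_def using finite_cosets by simp

lemma prime_form_in_conjugates: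
  assumes "f \<in> modular_forms \<kappa> \<Gamma>"
  shows "prime_form C \<alpha> \<kappa> f \<in> conjugates \<kappa> f"
  unfolding conjugates_eq[OF assms] using group_one slash_mat_1 by (metis image_eqI)

lemma conjugates_modular:
  assumes "f \<in> modular_forms \<kappa> \<Gamma>"
  shows "conjugates \<kappa> f \<subseteq> modular_forms \<kappa> {}"
proof -
  have "f \<in> modular_forms \<kappa> {}" using assms modular_forms_split by blast
  hence "prime_form C \<alpha> \<kappa> f \<in> modular_forms \<kappa> {}"
    unfolding prime_form_def by (intro modular_forms_scale modular_forms_empty_slash det_\<alpha>)
  thus ?thesis
    unfolding conjugates_eq[OF assms] using group_det by (auto intro: modular_forms_empty_slash)
qed

lemma slash_slash_group:
  assumes "\<gamma> \<in> \<Gamma>" "\<delta> \<in> \<Gamma>"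
  shows "slash \<kappa> (slash \<kappa> f \<gamma>) \<delta> = slash \<kappa> f (\<gamma> ** \<delta>)"
  using group_det[OF assms(1)] group_det[OF assms(2)] by (simp add: slash_slash)

lemma slash_group_inverse:
  assumes "\<delta> \<in> \<Gamma>"
  shows "slash \<kappa> (slash \<kappa> f \<delta>) (matrix_inv \<delta>) = f" "slash \<kappa> (slash \<kappa> f (matrix_inv \<delta>)) \<delta> = f"
  using group_det[OF assms] matrix_inv_mult[of \<delta>] group_inv[OF assms] assms
  by (simp_all add: slash_slash_group)

lemma conjugates_slash:
  assumes f: "f \<in> modular_forms \<kappa> \<Gamma>" and \<delta>: "\<delta> \<in> \<Gamma>"
  shows "(\<lambda>g. slash \<kappa> g \<delta>) ` conjugates \<kappa> f = conjugates \<kappa> f"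
proof -
  have closed: "slash \<kappa> g \<beta> \<in> conjugates \<kappa> f" if "g \<in> conjugates \<kappa> f" "\<beta> \<in> \<Gamma>" for g \<beta>
    using that group_mult unfolding conjugates_eq[OF f] by (auto simp: slash_slash_group)
  show ?thesis
  proof (intro equalityI subsetI)
    fix g assume "g \<in> conjugates \<kappa> f"
    hence "slash \<kappa> g (matrix_inv \<delta>) \<in> conjugates \<kappa> f" by (intro closed group_inv \<delta>)
    thus "g \<in> (\<lambda>g. slash \<kappa> g \<delta>) ` conjugates \<kappa> f"
      using slash_group_inverse(2)[OF \<delta>, of \<kappa> g] by (metis image_eqI)
  qed (use closed \<delta> in auto)
qed

lemma char_poly_conjugates_modular:
  assumes f: "f \<in> modular_forms \<kappa> \<Gamma>" and j: "j \<le> card (conjugates \<kappa> f)"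
  shows "coeff (char_poly (conjugates \<kappa> f)) j \<in> modular_forms ((card (conjugates \<kappa> f) - j) * \<kappa>) \<Gamma>"
proof (rule char_poly_coeff_modular[OF finite_conjugates conjugates_modular[OF f] _ _ conjugates_slash[OF f] j])
  fix \<delta> assume \<delta>: "\<delta> \<in> \<Gamma>"
  show "det \<delta> > 0" using group_det[OF \<delta>] by simp
  show "inj_on (\<lambda>g. slash \<kappa> g \<delta>) (conjugates \<kappa> f)"
    by (rule inj_on_inverseI[of _ "\<lambda>g. slash \<kappa> g (matrix_inv \<delta>)"]) (rule slash_group_inverse[OF \<delta>])
qed

lemma char_poly_conjugates_rational:
  assumes f: "f \<in> modular_forms \<kappa> \<Gamma>" "q_coeffs_in L f" and j: "j \<le> card (conjugates \<kappa> f)"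
  shows "q_coeffs_in L (coeff (char_poly (conjugates \<kappa> f)) j)"
proof (rule char_poly_coeff_rational[OF finite_conjugates conjugates_modular[OF f(1)]
      prime_form_in_conjugates[OF f(1)] prime_rational[OF f] _ _ j])
  show "\<exists>\<gamma>\<in>\<Gamma>. g = slash \<kappa> (prime_form C \<alpha> \<kappa> f) \<gamma>" if "g \<in> conjugates \<kappa> f" for g
    using that unfolding conjugates_eq[OF f(1)] by blast
qed (rule char_poly_conjugates_modular[OF f(1)])

text \<open>The group \<open>\<Gamma>\<close> permutes the cosets and acts transitively on the conjugates.\<close>

lemma card_conjugate_fibres:
  assumes f: "f \<in> modular_forms \<kappa> \<Gamma>" and g: "g \<in> conjugates \<kappa> f"
  shows "card {K \<in> cosets. conjugate_form \<kappa> f K = g} =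
    card {K \<in> cosets. conjugate_form \<kappa> f K = prime_form C \<alpha> \<kappa> f}"
proof -
  define N where "N = (\<lambda>g. card {K \<in> cosets. conjugate_form \<kappa> f K = g})"
  have le: "N h \<le> N (slash \<kappa> h \<delta>)" if \<delta>: "\<delta> \<in> \<Gamma>" for h \<delta>
    unfolding N_def
  proof (rule card_inj_on_le)
    let ?m = "\<lambda>M. M ** \<delta>"
    have "inj ?m"
    proof (rule injI)
      fix A B assume "A ** \<delta> = B ** \<delta>"
      hence "A ** \<delta> ** matrix_inv \<delta> = B ** \<delta> ** matrix_inv \<delta>" by simp
      thus "A = B"
        using matrix_inv_mult(1)[of \<delta>] group_det[OF \<delta>] by (simp flip: matrix_mul_assoc)
    qed
    hence "inj (\<lambda>K. ?m ` K)"
      by (intro injI) (rule inj_image_eq_iff[THEN iffD1])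
    thus "inj_on (\<lambda>K. ?m ` K) {K \<in> cosets. conjugate_form \<kappa> f K = h}"
      by (rule inj_on_subset) simp
    show "(\<lambda>K. ?m ` K) ` {K \<in> cosets. conjugate_form \<kappa> f K = h} \<subseteq>
        {K \<in> cosets. conjugate_form \<kappa> f K = slash \<kappa> h \<delta>}"
    proof safe
      fix K assume "K \<in> cosets"
      then obtain \<gamma> where \<gamma>: "\<gamma> \<in> \<Gamma>" "K = (\<lambda>\<delta>. \<delta> ** \<gamma>) ` hecke_subgroup \<Gamma> \<alpha>"
        unfolding right_cosets_def by blast
      have K\<delta>: "?m ` K = (\<lambda>\<beta>. \<beta> ** (\<gamma> ** \<delta>)) ` hecke_subgroup \<Gamma> \<alpha>"
        unfolding \<gamma>(2) image_image matrix_mul_assoc ..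
      show "?m ` K \<in> cosets"
        unfolding K\<delta> right_cosets_def using group_mult[OF \<gamma>(1) \<delta>] by blast
      show "conjugate_form \<kappa> f (?m ` K) = slash \<kappa> (conjugate_form \<kappa> f K) \<delta>"
        unfolding K\<delta> unfolding \<gamma>(2) conjugate_form_coset[OF f \<gamma>(1)] conjugate_form_coset[OF f group_mult[OF \<gamma>(1) \<delta>]]
          slash_slash_group[OF \<gamma>(1) \<delta>] ..
    qed
  qed (use finite_cosets in simp)
  obtain \<gamma> where \<gamma>: "\<gamma> \<in> \<Gamma>" "g = slash \<kappa> (prime_form C \<alpha> \<kappa> f) \<gamma>"
    using g unfolding conjugates_eq[OF f] by blast
  have "N (prime_form C \<alpha> \<kappa> f) \<le> N g" unfolding \<gamma>(2) by (rule le[OF \<gamma>(1)])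
  moreover have "N g \<le> N (prime_form C \<alpha> \<kappa> f)"
    using le[OF group_inv[OF \<gamma>(1)], of g] unfolding \<gamma>(2) slash_group_inverse[OF \<gamma>(1)] .
  ultimately show ?thesis unfolding N_def by simp
qed

lemma hecke_eq: "hecke \<Gamma> \<alpha> C c \<kappa> f = fun_scale c (\<Sum>K\<in>cosets. conjugate_form \<kappa> f K)"
  unfolding hecke_def conjugate_form_def ..

text \<open>
  Every conjugate of \<open>f'\<close> belongs to the same number \<open>n\<close> of cosets, so the sum over the cosets is \<open>n\<close>
  times the sum of the distinct conjugates, and the latter is a coefficient of their characteristic
  polynomial. Modularity and rationality of the Hecke operator are thus inherited from this
  coefficient.
\<close>

lemma hecke_eq_subleading:
  assumes f: "f \<in> modular_forms \<kappa> \<Gamma>"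
  shows "\<exists>n. hecke \<Gamma> \<alpha> C c \<kappa> f =
    fun_scale (- c * of_nat n) (coeff (char_poly (conjugates \<kappa> f)) (card (conjugates \<kappa> f) - 1))"
proof -
  let ?G = "conjugates \<kappa> f" and ?m = "coeff (char_poly (conjugates \<kappa> f)) (card (conjugates \<kappa> f) - 1)"
  define n where "n = card {K \<in> cosets. conjugate_form \<kappa> f K = prime_form C \<alpha> \<kappa> f}"
  have fibre: "(\<Sum>K\<in>{K \<in> cosets. conjugate_form \<kappa> f K = g}. conjugate_form \<kappa> f K \<tau>) = of_nat n * g \<tau>"
    if "g \<in> ?G" for g \<tau>
    using card_conjugate_fibres[OF f that] by (simp add: n_def)
  have "?G \<noteq> {}" using prime_form_in_conjugates[OF f] by blast
  note sub = char_poly_subleading[OF finite_conjugates this]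
  have "hecke \<Gamma> \<alpha> C c \<kappa> f \<tau> = fun_scale (- c * of_nat n) ?m \<tau>" for \<tau>
  proof -
    have "(\<Sum>K\<in>cosets. conjugate_form \<kappa> f K \<tau>) =
        (\<Sum>g\<in>?G. \<Sum>K\<in>{K \<in> cosets. conjugate_form \<kappa> f K = g}. conjugate_form \<kappa> f K \<tau>)"
      unfolding conjugates_def by (rule sum.image_gen[OF finite_cosets])
    also have "\<dots> = (\<Sum>g\<in>?G. of_nat n * g \<tau>)"
      by (intro sum.cong refl fibre)
    also have "\<dots> = of_nat n * (\<Sum>g\<in>?G. g) \<tau>"
      by (simp add: fun_sum_apply sum_distrib_left)
    also have "\<dots> = of_nat n * - (?m \<tau>)"
      unfolding sub by simp
    finally show ?thesis
      unfolding hecke_eq by (simp add: fun_scale_def fun_sum_apply)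
  qed
  thus ?thesis by blast
qed

lemma hecke_modular:
  assumes f: "f \<in> modular_forms \<kappa> \<Gamma>"
  shows "hecke \<Gamma> \<alpha> C c \<kappa> f \<in> modular_forms \<kappa> \<Gamma>"
proof -
  let ?n = "card (conjugates \<kappa> f)"
  have "?n > 0" using prime_form_in_conjugates[OF f] finite_conjugates by (auto simp: card_gt_0_iff)
  hence wt: "(?n - (?n - 1)) * \<kappa> = \<kappa>" by (cases ?n) simp_all
  have "coeff (char_poly (conjugates \<kappa> f)) (?n - 1) \<in> modular_forms ((?n - (?n - 1)) * \<kappa>) \<Gamma>"
    by (rule char_poly_conjugates_modular[OF f]) simp
  hence "coeff (char_poly (conjugates \<kappa> f)) (?n - 1) \<in> modular_forms \<kappa> \<Gamma>"
    unfolding wt .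
  thus ?thesis using hecke_eq_subleading[OF f, of c] modular_forms_scale by metis
qed

lemma hecke_rational:
  assumes f: "f \<in> modular_forms \<kappa> \<Gamma>" "q_coeffs_in L f" and c: "c \<in> L"
  shows "q_coeffs_in L (hecke \<Gamma> \<alpha> C c \<kappa> f)"
proof -
  have "q_coeffs_in L (coeff (char_poly (conjugates \<kappa> f)) (card (conjugates \<kappa> f) - 1))"
    by (rule char_poly_conjugates_rational[OF f]) simp
  moreover have "- c * of_nat n \<in> L" for n
    by (intro L_mult L_uminus c L_of_nat)
  ultimately show ?thesis
    using hecke_eq_subleading[OF f(1), of c] q_coeffs_in_scale by metis
qed

end


section \<open>Multivariate power series\<close>

lemma finite_bounded_exponents:
  fixes D :: "'r::finite \<Rightarrow> nat"
  shows "finite {e :: 'r \<Rightarrow>\<^sub>0 nat. \<forall>i. Poly_Mapping.lookup e i \<le> D i}"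
proof (rule finite_imageD)
  have "Poly_Mapping.lookup ` {e :: 'r \<Rightarrow>\<^sub>0 nat. \<forall>i. Poly_Mapping.lookup e i \<le> D i} \<subseteq> (\<Pi>\<^sub>E i\<in>UNIV. {..D i})"
    by (auto simp: PiE_iff)
  thus "finite (Poly_Mapping.lookup ` {e :: 'r \<Rightarrow>\<^sub>0 nat. \<forall>i. Poly_Mapping.lookup e i \<le> D i})"
    by (rule finite_subset) (intro finite_PiE finite_atMost finite)
  show "inj_on Poly_Mapping.lookup {e :: 'r \<Rightarrow>\<^sub>0 nat. \<forall>i. Poly_Mapping.lookup e i \<le> D i}"
    by (rule inj_onI) (simp only: poly_mapping_eq_iff)
qed

lemma finite_decompositions: "finite {(k, l). k + l = n}" for n :: "'r::finite \<Rightarrow>\<^sub>0 nat"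
proof (rule finite_subset)
  let ?S = "{e :: 'r \<Rightarrow>\<^sub>0 nat. \<forall>i. Poly_Mapping.lookup e i \<le> Poly_Mapping.lookup n i}"
  show "{(k, l). k + l = n} \<subseteq> ?S \<times> ?S"
    by (auto simp: lookup_add)
  show "finite (?S \<times> ?S)"
    by (intro finite_cartesian_product finite_bounded_exponents)
qed

lemma mpseries_mult_commute: "mpseries_mult F G = mpseries_mult G F"
  for F G :: "('r, 'a::comm_ring_1) mpseries"
proof
  fix n
  show "mpseries_mult F G n = mpseries_mult G F n"
    unfolding mpseries_mult_def
    by (rule sum.reindex_bij_witness[of _ "\<lambda>(k, l). (l, k)" "\<lambda>(k, l). (l, k)"])
       (auto simp: add.commute mult.commute)
qed

lemma mpseries_mult_assoc: "mpseries_mult (mpseries_mult F G) H = mpseries_mult F (mpseries_mult G H)"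
  for F G H :: "('r::finite, 'a::comm_ring_1) mpseries"
proof
  fix n :: "'r \<Rightarrow>\<^sub>0 nat"
  define D where "D = (\<lambda>n :: 'r \<Rightarrow>\<^sub>0 nat. {(k, l). k + l = n})"
  define i where "i = (\<lambda>((k :: 'r \<Rightarrow>\<^sub>0 nat, t :: 'r \<Rightarrow>\<^sub>0 nat), (m :: 'r \<Rightarrow>\<^sub>0 nat, l :: 'r \<Rightarrow>\<^sub>0 nat)). ((k + m, l), (k, m)))"
  define j where "j = (\<lambda>((s :: 'r \<Rightarrow>\<^sub>0 nat, l :: 'r \<Rightarrow>\<^sub>0 nat), (k :: 'r \<Rightarrow>\<^sub>0 nat, m :: 'r \<Rightarrow>\<^sub>0 nat)). ((k, m + l), (m, l)))"
  have fin: "finite (D m)" for m unfolding D_def by (rule finite_decompositions)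
  have "mpseries_mult (mpseries_mult F G) H n = (\<Sum>x\<in>D n. \<Sum>y\<in>D (fst x). F (fst y) * G (snd y) * H (snd x))"
    unfolding mpseries_mult_def D_def case_prod_unfold sum_distrib_right ..
  also have "\<dots> = (\<Sum>(x, y)\<in>Sigma (D n) (\<lambda>x. D (fst x)). F (fst y) * G (snd y) * H (snd x))"
    by (intro sum.Sigma[where A = "D n" and B = "\<lambda>x. D (fst x)"] ballI fin)
  also have "\<dots> = (\<Sum>(x, y)\<in>Sigma (D n) (\<lambda>x. D (snd x)). F (fst x) * (G (fst y) * H (snd y)))"
  proof (rule sum.reindex_bij_witness[of _ i j])
    fix p assume in_Sigma: "p \<in> Sigma (D n) (\<lambda>x. D (fst x))"
    obtain s l k m where p: "p = ((s, l), (k, m))" by (metis surj_pair)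
    have e: "s = k + m" "n = s + l" using in_Sigma by (simp_all add: D_def p)
    show "i (j p) = p" by (simp add: i_def j_def p e)
    show "j p \<in> Sigma (D n) (\<lambda>x. D (snd x))" by (simp add: j_def p e D_def add.assoc)
    show "(case j p of (x, y) \<Rightarrow> F (fst x) * (G (fst y) * H (snd y))) =
        (case p of (x, y) \<Rightarrow> F (fst y) * G (snd y) * H (snd x))"
      by (simp add: j_def p)
  next
    fix p assume in_Sigma: "p \<in> Sigma (D n) (\<lambda>x. D (snd x))"
    obtain k t m l where p: "p = ((k, t), (m, l))" by (metis surj_pair)
    have e: "t = m + l" "n = k + t" using in_Sigma by (simp_all add: D_def p)
    show "j (i p) = p" by (simp add: i_def j_def p e)
    show "i p \<in> Sigma (D n) (\<lambda>x. D (fst x))" by (simp add: i_def p e D_def add.assoc)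
  qed
  also have "\<dots> = (\<Sum>x\<in>D n. \<Sum>y\<in>D (snd x). F (fst x) * (G (fst y) * H (snd y)))"
    by (intro sum.Sigma[where A = "D n" and B = "\<lambda>x. D (snd x)", symmetric] ballI fin)
  also have "\<dots> = mpseries_mult F (mpseries_mult G H) n"
    unfolding mpseries_mult_def D_def case_prod_unfold sum_distrib_left ..
  finally show "mpseries_mult (mpseries_mult F G) H n = mpseries_mult F (mpseries_mult G H) n" .
qed

definition unit_series :: "('r, 'a::comm_ring_1) mpseries"
  where "unit_series e = (if e = 0 then 1 else 0)"

lemma mpseries_mult_unit: "mpseries_mult unit_series F = F"
  for F :: "('r::finite, 'a::comm_ring_1) mpseries"
proof
  fix n :: "'r \<Rightarrow>\<^sub>0 nat"
  have "mpseries_mult unit_series F n = (\<Sum>(k, l)\<in>{(0 :: 'r \<Rightarrow>\<^sub>0 nat, n)}. unit_series k * F l)"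
    unfolding mpseries_mult_def
    by (rule sum.mono_neutral_right) (auto simp: finite_decompositions unit_series_def split: if_splits)
  thus "mpseries_mult unit_series F n = F n" by (simp add: unit_series_def)
qed

lemma mpseries_mult_zero_exponent: "mpseries_mult F G 0 = F 0 * G 0"
  for F G :: "('r::finite, 'a::comm_ring_1) mpseries"
proof -
  have "{(k, l). k + l = (0 :: 'r \<Rightarrow>\<^sub>0 nat)} = {(0, 0)}"
    by (auto simp: poly_mapping_eq_iff lookup_add fun_eq_iff)
  thus ?thesis by (simp add: mpseries_mult_def)
qed

definition finite_support :: "('r, 'a::zero) mpseries \<Rightarrow> bool"
  where "finite_support F \<longleftrightarrow> finite {e. F e \<noteq> 0}"

definition vanishes_beyond :: "'r \<Rightarrow> ('r, 'a::zero) mpseries \<Rightarrow> bool"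
  where "vanishes_beyond i F \<longleftrightarrow> (\<exists>D. \<forall>e. D \<le> Poly_Mapping.lookup e i \<longrightarrow> F e = 0)"

lemma finite_support_mult:
  fixes F G :: "('r, 'a::comm_ring_1) mpseries"
  assumes "finite_support F" "finite_support G"
  shows "finite_support (mpseries_mult F G)"
  unfolding finite_support_def
proof (rule finite_subset)
  show "{e. mpseries_mult F G e \<noteq> 0} \<subseteq> (\<lambda>(k, l). k + l) ` ({e. F e \<noteq> 0} \<times> {e. G e \<noteq> 0})"
  proof
    fix e assume "e \<in> {e. mpseries_mult F G e \<noteq> 0}"
    hence "(\<Sum>(k, l)\<in>{(k, l). k + l = e}. F k * G l) \<noteq> 0" by (simp add: mpseries_mult_def)
    then obtain k l where "k + l = e" "F k * G l \<noteq> 0"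
      by (auto elim!: sum.not_neutral_contains_not_neutral)
    thus "e \<in> (\<lambda>(k, l). k + l) ` ({e. F e \<noteq> 0} \<times> {e. G e \<noteq> 0})"
      by (auto intro!: image_eqI[of _ _ "(k, l)"])
  qed
qed (use assms in \<open>auto simp: finite_support_def\<close>)

lemma finite_support_unit: "finite_support (unit_series :: ('r, 'a::comm_ring_1) mpseries)"
  unfolding finite_support_def by (rule finite_subset[of _ "{0}"]) (auto simp: unit_series_def)

lemma vanishes_beyond_mult:
  fixes Q F :: "('r, 'a::comm_ring_1) mpseries"
  assumes "finite_support Q" "vanishes_beyond i F"
  shows "vanishes_beyond i (mpseries_mult Q F)"
proof -
  obtain D where D: "\<And>e. D \<le> Poly_Mapping.lookup e i \<Longrightarrow> F e = 0"
    using assms(2) by (auto simp: vanishes_beyond_def)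
  have "finite ((\<lambda>e. Poly_Mapping.lookup e i) ` {e. Q e \<noteq> 0})"
    using assms(1) by (simp add: finite_support_def)
  then obtain B where B: "\<And>e. Q e \<noteq> 0 \<Longrightarrow> Poly_Mapping.lookup e i \<le> B"
    unfolding finite_nat_set_iff_bounded_le by blast
  have "mpseries_mult Q F e = 0" if e: "B + D \<le> Poly_Mapping.lookup e i" for e
    unfolding mpseries_mult_def
  proof (rule sum.neutral, safe)
    fix k l assume "e = k + l"
    hence kl: "Poly_Mapping.lookup e i = Poly_Mapping.lookup k i + Poly_Mapping.lookup l i"
      by (simp add: lookup_add)
    show "Q k * F l = 0"
    proof (cases "Q k = 0")
      case False
      hence "D \<le> Poly_Mapping.lookup l i" using B[OF False] e kl by linarith
      thus ?thesis using D by simp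
    qed simp
  qed
  thus ?thesis unfolding vanishes_beyond_def by blast
qed

lemma vanishes_beyond_imp_finite_support:
  fixes F :: "('r::finite, 'a::zero) mpseries"
  assumes "\<And>i. vanishes_beyond i F"
  shows "finite_support F"
proof -
  obtain D where D: "\<And>i e. D i \<le> Poly_Mapping.lookup e i \<Longrightarrow> F e = 0"
    using assms unfolding vanishes_beyond_def by metis
  have "{e. F e \<noteq> 0} \<subseteq> {e. \<forall>i. Poly_Mapping.lookup e i \<le> D i}"
    using D by (auto intro: nat_le_linear[THEN disjE])
  thus ?thesis
    unfolding finite_support_def by (rule finite_subset) (rule finite_bounded_exponents)
qed


section \<open>Dickson's lemma\<close>

text \<open>
  A decreasing sequence of natural numbers is constant from the place where its minimum occurs.
\<close>

lemma nat_sequence_incseq_subsequence: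
  fixes s :: "nat \<Rightarrow> nat"
  shows "\<exists>g. strict_mono g \<and> incseq (s \<circ> g)"
proof -
  obtain g :: "nat \<Rightarrow> nat" where g: "strict_mono g" "monoseq (\<lambda>n. s (g n))"
    using seq_monosub[of s] by auto
  show ?thesis
  proof (cases "incseq (\<lambda>n. s (g n))")
    case True
    thus ?thesis using g(1) by (auto simp: o_def)
  next
    case False
    hence dec: "decseq (\<lambda>n. s (g n))" using g(2) by (simp add: monoseq_iff)
    define m where "m = (LEAST v. \<exists>n. s (g n) = v)"
    obtain n0 where n0: "s (g n0) = m" unfolding m_def
      using LeastI_ex[of "\<lambda>v. \<exists>n. s (g n) = v"] by blast
    have "s (g (n + n0)) = m" for n
    proof (rule antisym)
      show "s (g (n + n0)) \<le> m" using decseqD[OF dec, of n0 "n + n0"] n0 by simp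
      show "m \<le> s (g (n + n0))" unfolding m_def by (rule Least_le) blast
    qed
    hence "incseq (s \<circ> (\<lambda>n. g (n + n0)))" by (simp add: incseq_def)
    moreover have "strict_mono (\<lambda>n. g (n + n0))" using g(1) by (simp add: strict_mono_def)
    ultimately show ?thesis by blast
  qed
qed

lemma exponent_sequence_incseq_subsequence:
  fixes x :: "nat \<Rightarrow> 'r \<Rightarrow> nat"
  assumes "finite S"
  shows "\<exists>h. strict_mono h \<and> (\<forall>i\<in>S. incseq (\<lambda>n. x (h n) i))"
  using assms
proof (induction S)
  case empty
  show ?case by (rule exI[of _ id]) (simp add: strict_mono_def)
next
  case (insert j S)
  then obtain h where h: "strict_mono h" "\<forall>i\<in>S. incseq (\<lambda>n. x (h n) i)" by blast
  obtain g where g: "strict_mono g" "incseq ((\<lambda>n. x (h n) j) \<circ> g)"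
    using nat_sequence_incseq_subsequence by blast
  have "strict_mono (h \<circ> g)" using h(1) g(1) by (rule strict_mono_o)
  moreover have "incseq (\<lambda>n. x ((h \<circ> g) n) i)" if "i \<in> insert j S" for i
  proof (cases "i = j")
    case True
    thus ?thesis using g(2) by (simp add: o_def)
  next
    case False
    hence "incseq (\<lambda>n. x (h n) i)" using h(2) that by blast
    thus ?thesis using g(1) by (simp add: incseq_def strict_mono_leD)
  qed
  ultimately show ?case by blast
qed

lemma exponent_le_imp_add:
  fixes s t :: "'r \<Rightarrow>\<^sub>0 nat"
  assumes "\<And>i. Poly_Mapping.lookup s i \<le> Poly_Mapping.lookup t i"
  shows "s + (t - s) = t"
  using assms by (intro poly_mapping_eqI) (simp add: lookup_add lookup_minus)

text \<open>
  Otherwise there are exponents outside \<open>E\<close> with arbitrarily large \<open>i\<close>-th entry that enter \<open>E\<close> at the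
  next step in direction \<open>i\<close>. A subsequence of them increases in every entry, and some later member
  lies above the successor of its first member, hence in \<open>E\<close>.
\<close>

lemma upward_closed_stabilizes:
  fixes E :: "('r::finite \<Rightarrow>\<^sub>0 nat) set"
  assumes up: "\<And>e s. e \<in> E \<Longrightarrow> e + s \<in> E"
  shows "\<exists>D. \<forall>e. D \<le> Poly_Mapping.lookup e i \<longrightarrow> (e + Poly_Mapping.single i 1 \<in> E \<longleftrightarrow> e \<in> E)"
proof (rule ccontr)
  assume "\<not> ?thesis"
  hence "\<forall>D. \<exists>e. D \<le> Poly_Mapping.lookup e i \<and> e \<notin> E \<and> e + Poly_Mapping.single i 1 \<in> E"
    using up by blast
  then obtain x where x: "\<And>D. D \<le> Poly_Mapping.lookup (x D) i" "\<And>D. x D \<notin> E"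
    "\<And>D. x D + Poly_Mapping.single i 1 \<in> E" by metis
  obtain h where h: "strict_mono h" "\<And>j. incseq (\<lambda>n. Poly_Mapping.lookup (x (h n)) j)"
    using exponent_sequence_incseq_subsequence[of "UNIV :: 'r set" "\<lambda>D. Poly_Mapping.lookup (x D)"] by auto
  define n where "n = Suc (Poly_Mapping.lookup (x (h 0)) i)"
  have "n \<le> Poly_Mapping.lookup (x (h n)) i"
    using x(1)[of "h n"] seq_suble[OF h(1), of n] by linarith
  moreover have "Poly_Mapping.lookup (x (h 0)) j \<le> Poly_Mapping.lookup (x (h n)) j" for j
    using incseqD[OF h(2), of 0 n] by simp
  ultimately have "Poly_Mapping.lookup (x (h 0) + Poly_Mapping.single i 1) j \<le> Poly_Mapping.lookup (x (h n)) j" for j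
    unfolding n_def by (auto simp: lookup_add lookup_single when_def)
  from exponent_le_imp_add[OF this] up[OF x(3)] have "x (h n) \<in> E" by metis
  thus False using x(2) by blast
qed

lemma initial_ideal_upward_closed:
  assumes "e \<notin> standard_exponents ord I"
  shows "e + s \<notin> standard_exponents ord I"
proof -
  have "Poly_Mapping.single e 1 \<in> initial_ideal ord I"
    using assms by (simp add: standard_exponents_def)
  hence "Poly_Mapping.single s 1 * Poly_Mapping.single e 1 \<in> initial_ideal ord I"
    unfolding initial_ideal_def by (rule ideal.span_scale)
  thus ?thesis by (simp add: standard_exponents_def mult_single add.commute)
qed

text \<open>
  The generating function is a sum over the complement of a monomial ideal. Far enough in one
  direction, membership in the complement no longer changes in that direction.
\<close>

lemma standard_exponents_stabilize:
  fixes ord :: "('r::finite \<Rightarrow>\<^sub>0 nat) rel"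
  shows "\<exists>D. \<forall>e. D \<le> Poly_Mapping.lookup e i \<longrightarrow>
    (\<forall>t. e + Poly_Mapping.single i t \<in> standard_exponents ord I \<longleftrightarrow> e \<in> standard_exponents ord I)"
proof -
  obtain D where D: "\<And>e. D \<le> Poly_Mapping.lookup e i \<Longrightarrow>
      e + Poly_Mapping.single i 1 \<in> - standard_exponents ord I \<longleftrightarrow> e \<in> - standard_exponents ord I"
    using upward_closed_stabilizes[of "- standard_exponents ord I" i] initial_ideal_upward_closed[of _ ord I]
    by auto
  have "e + Poly_Mapping.single i t \<in> standard_exponents ord I \<longleftrightarrow> e \<in> standard_exponents ord I"
    if "D \<le> Poly_Mapping.lookup e i" for e t
  proof (induction t)
    case (Suc t)
    have "e + Poly_Mapping.single i (Suc t) = (e + Poly_Mapping.single i t) + Poly_Mapping.single i 1"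
      by (simp add: add.assoc flip: single_add)
    moreover have "D \<le> Poly_Mapping.lookup (e + Poly_Mapping.single i t) i"
      using that by (simp add: lookup_add)
    ultimately show ?case using D Suc by auto
  qed simp
  thus ?thesis by blast
qed


section \<open>Rational series and their polynomial representatives\<close>

lemma mpoly_eval_superset:
  assumes "finite S" "Poly_Mapping.keys p \<subseteq> S" "\<phi> 0 = 0"
  shows "mpoly_eval \<phi> x p =
    (\<Sum>m\<in>S. \<phi> (Poly_Mapping.lookup p m) * (\<Prod>i\<in>Poly_Mapping.keys m. x i ^ Poly_Mapping.lookup m i))"
  unfolding mpoly_eval_def
  by (rule sum.mono_neutral_left) (use assms in \<open>auto simp: in_keys_iff\<close>)

lemma mpoly_eval_add:
  assumes "\<phi> 0 = 0" "\<And>c d. \<phi> (c + d) = \<phi> c + \<phi> d"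
  shows "mpoly_eval \<phi> x (p + q) = mpoly_eval \<phi> x p + mpoly_eval \<phi> x q"
proof -
  let ?S = "Poly_Mapping.keys p \<union> Poly_Mapping.keys q"
  note eq = mpoly_eval_superset[where S = ?S and \<phi> = \<phi> and x = x, OF _ _ assms(1)]
  show ?thesis
    using keys_add[of p q] by (simp add: eq lookup_add assms(2) distrib_right sum.distrib)
qed

lemma mpoly_eval_single:
  assumes "\<phi> 0 = 0"
  shows "mpoly_eval \<phi> x (Poly_Mapping.single m c) =
    \<phi> c * (\<Prod>i\<in>Poly_Mapping.keys m. x i ^ Poly_Mapping.lookup m i)"
  using mpoly_eval_superset[of "{m}" "Poly_Mapping.single m c" \<phi> x] assms by simp

lemma single_sum: "Poly_Mapping.single k (\<Sum>x\<in>A. f x) = (\<Sum>x\<in>A. Poly_Mapping.single k (f x))"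
  for f :: "'i \<Rightarrow> 'a::comm_monoid_add"
  by (induction A rule: infinite_finite_induct) (simp_all add: single_add)

lemma exponent_eq_sum_single: "(\<Sum>i\<in>UNIV. Poly_Mapping.single i (Poly_Mapping.lookup e i)) = e"
  for e :: "'r::finite \<Rightarrow>\<^sub>0 nat"
  by (rule poly_mapping_eqI) (simp add: lookup_sum lookup_single when_def)

lemma single_generator_power:
  "Poly_Mapping.single (Poly_Mapping.single i (1 :: nat)) (1 :: 'a::comm_ring_1) ^ n =
    Poly_Mapping.single (Poly_Mapping.single i n) 1"
  by (induction n) (simp_all add: mult_single flip: single_add)

lemma graded_const_zero [simp]: "graded_const 0 = 0"
  by (simp add: graded_const_def flip: zero_fun_def)

lemma graded_const_add: "graded_const (c + d) = graded_const c + graded_const d"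
  by (simp add: graded_const_def plus_fun_def flip: single_add)

lemma image_over_graded_ring_add:
  "image_over_graded_ring wt a (p + q) = image_over_graded_ring wt a p + image_over_graded_ring wt a q"
  unfolding image_over_graded_ring_def
  by (rule mpoly_eval_add) (simp_all add: graded_const_add single_add)

lemma image_over_graded_ring_zero: "image_over_graded_ring wt a 0 = 0"
  by (simp add: image_over_graded_ring_def mpoly_eval_def)

lemma image_over_graded_ring_monomial:
  fixes u e :: "'r::finite \<Rightarrow>\<^sub>0 nat"
  shows "\<exists>m. image_over_graded_ring wt a (Poly_Mapping.single m c) =
    Poly_Mapping.single e (Poly_Mapping.single (exponent_weight wt u) (fun_scale c (monomial_form a u)))"
proof -
  define m :: "'r + 'r \<Rightarrow>\<^sub>0 nat" where "m = Abs_poly_mapping (case_sum (Poly_Mapping.lookup u) (Poly_Mapping.lookup e))"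
  have m: "Poly_Mapping.lookup m = case_sum (Poly_Mapping.lookup u) (Poly_Mapping.lookup e)"
    unfolding m_def by (rule lookup_Abs_poly_mapping) simp
  define y :: "'r + 'r \<Rightarrow> ('r, graded_form) mpoly" where
    "y = case_sum (\<lambda>i. Poly_Mapping.single 0 (Poly_Mapping.single (wt i) (a i)))
                  (\<lambda>i. Poly_Mapping.single (Poly_Mapping.single i 1) 1)"
  have "(\<Prod>s\<in>Poly_Mapping.keys m. y s ^ Poly_Mapping.lookup m s) = (\<Prod>s\<in>UNIV <+> UNIV. y s ^ Poly_Mapping.lookup m s)"
    unfolding prod_keys_eq_UNIV by simp
  also have "\<dots> = (\<Prod>i\<in>UNIV. y (Inl i) ^ Poly_Mapping.lookup u i) * (\<Prod>i\<in>UNIV. y (Inr i) ^ Poly_Mapping.lookup e i)"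
    by (subst prod.Plus) (simp_all add: m o_def)
  also have "(\<Prod>i\<in>UNIV. y (Inl i) ^ Poly_Mapping.lookup u i) =
      Poly_Mapping.single 0 (Poly_Mapping.single (exponent_weight wt u) (monomial_form a u))"
  proof -
    have "Poly_Mapping.single (0 :: 'r \<Rightarrow>\<^sub>0 nat) x ^ n = Poly_Mapping.single 0 (x ^ n)" for x :: graded_form and n
      by (induction n) (simp_all add: mult_single)
    thus ?thesis by (simp add: y_def single_prod graded_monomial)
  qed
  also have "(\<Prod>i\<in>UNIV. y (Inr i) ^ Poly_Mapping.lookup e i) = Poly_Mapping.single e 1"
    by (simp add: y_def single_generator_power single_prod exponent_eq_sum_single del: One_nat_def)
  finally have prod: "(\<Prod>s\<in>Poly_Mapping.keys m. y s ^ Poly_Mapping.lookup m s) =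
      Poly_Mapping.single e (Poly_Mapping.single (exponent_weight wt u) (monomial_form a u))"
    by (simp add: mult_single)
  have "image_over_graded_ring wt a (Poly_Mapping.single m c) =
      Poly_Mapping.single 0 (graded_const c) * (\<Prod>s\<in>Poly_Mapping.keys m. y s ^ Poly_Mapping.lookup m s)"
    unfolding image_over_graded_ring_def y_def
    by (rule mpoly_eval_single) simp
  also have "\<dots> = Poly_Mapping.single e (Poly_Mapping.single (exponent_weight wt u) (fun_scale c (monomial_form a u)))"
    unfolding prod by (simp add: mult_single graded_const_def fun_scale_eq_mult)
  finally show ?thesis by blast
qed

lemma exponent_weight_add: "exponent_weight wt (e + s) = exponent_weight wt e + exponent_weight wt s"
  by (simp add: exponent_weight_def lookup_add distrib_right sum.distrib)

lemma exponent_weight_single: "exponent_weight wt (Poly_Mapping.single i n) = n * wt i"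
proof -
  have "exponent_weight wt (Poly_Mapping.single i n) = (\<Sum>j\<in>UNIV. if i = j then n * wt j else 0)"
    unfolding exponent_weight_def by (intro sum.cong) (auto simp: lookup_single when_def)
  thus ?thesis by simp
qed

lemma exponent_weight_zero [simp]: "exponent_weight wt 0 = 0"
  by (simp add: exponent_weight_def)

context rational_generators
begin

text \<open>
  The homogeneous elements of weight \<open>\<kappa>\<close> in \<open>\<R>\<^sub>\<Gamma>\<close> with \<open>q\<close>-coefficients in \<open>L\<close>. In the rational series
  below, the coefficient of a monomial in the \<open>A\<^sub>i\<close> has the weight of the same monomial in the \<open>a\<^sub>i\<close>.
\<close>

definition rational_component :: "nat \<Rightarrow> graded_form set"
  where "rational_component \<kappa> = {Poly_Mapping.single \<kappa> f | f. f \<in> modular_forms \<kappa> \<Gamma> \<and> q_coeffs_in L f}"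

definition rational_series :: "('r, graded_form) mpseries \<Rightarrow> bool"
  where "rational_series F \<longleftrightarrow> (\<forall>e. F e \<in> rational_component (exponent_weight wt e))"

lemma rational_componentI:
  "f \<in> modular_forms \<kappa> \<Gamma> \<Longrightarrow> q_coeffs_in L f \<Longrightarrow> Poly_Mapping.single \<kappa> f \<in> rational_component \<kappa>"
  by (auto simp: rational_component_def)

lemma rational_component_zero: "0 \<in> rational_component \<kappa>"
  using rational_componentI[OF modular_forms_zero q_coeffs_in_zero] by simp

lemma rational_component_one: "1 \<in> rational_component 0"
  using rational_componentI[OF modular_forms_one q_coeffs_in_one] by simp

lemma rational_component_add:
  assumes "x \<in> rational_component \<kappa>" "y \<in> rational_component \<kappa>"
  shows "x + y \<in> rational_component \<kappa>"
proof -
  obtain f g where fg: "x = Poly_Mapping.single \<kappa> f" "f \<in> modular_forms \<kappa> \<Gamma>" "q_coeffs_in L f"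
    "y = Poly_Mapping.single \<kappa> g" "g \<in> modular_forms \<kappa> \<Gamma>" "q_coeffs_in L g"
    using assms unfolding rational_component_def by blast
  show ?thesis
    unfolding fg(1,4) single_add [symmetric]
    by (intro rational_componentI modular_forms_add q_coeffs_in_add fg)
qed

lemma rational_component_mult:
  assumes "x \<in> rational_component \<kappa>" "y \<in> rational_component \<kappa>'"
  shows "x * y \<in> rational_component (\<kappa> + \<kappa>')"
proof -
  obtain f g where fg: "x = Poly_Mapping.single \<kappa> f" "f \<in> modular_forms \<kappa> \<Gamma>" "q_coeffs_in L f"
    "y = Poly_Mapping.single \<kappa>' g" "g \<in> modular_forms \<kappa>' \<Gamma>" "q_coeffs_in L g"
    using assms unfolding rational_component_def by blast
  show ?thesis
    unfolding fg(1,4) mult_single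
    by (intro rational_componentI modular_forms_mult q_coeffs_in_mult fg)
qed

lemma rational_component_sum:
  "(\<And>x. x \<in> A \<Longrightarrow> f x \<in> rational_component \<kappa>) \<Longrightarrow> (\<Sum>x\<in>A. f x) \<in> rational_component \<kappa>"
  by (induction A rule: infinite_finite_induct) (simp_all add: rational_component_zero rational_component_add)

lemma rational_series_mult:
  assumes "rational_series F" "rational_series G"
  shows "rational_series (mpseries_mult F G)"
  unfolding rational_series_def mpseries_mult_def
proof (intro allI rational_component_sum, safe)
  fix k l :: "'r \<Rightarrow>\<^sub>0 nat"
  show "F k * G l \<in> rational_component (exponent_weight wt (k + l))"
    using assms unfolding exponent_weight_add rational_series_def by (blast intro: rational_component_mult)
qed

lemma rational_series_unit: "rational_series unit_series"
  by (auto simp: rational_series_def unit_series_def rational_component_zero rational_component_one)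

lemma rational_component_subset_graded_ring: "rational_component \<kappa> \<subseteq> graded_ring \<Gamma>"
  by (auto simp: rational_component_def graded_ring_def lookup_single when_def)

text \<open>
  The image of \<open>L[a\<^sub>1,\<dots>,a\<^sub>r,A\<^sub>1,\<dots>,A\<^sub>r]\<close> in \<open>\<R>\<^sub>\<Gamma>[A\<^sub>1,\<dots>,A\<^sub>r]\<close>.
\<close>

definition rational_polynomials :: "('r, graded_form) mpoly set"
  where "rational_polynomials = {image_over_graded_ring wt a P | P. \<forall>m. Poly_Mapping.lookup P m \<in> L}"

lemma rational_polynomials_zero: "0 \<in> rational_polynomials"
  unfolding rational_polynomials_def
  by (rule CollectI, rule exI[of _ 0]) (simp add: image_over_graded_ring_zero)

lemma rational_polynomials_add:
  assumes "x \<in> rational_polynomials" "y \<in> rational_polynomials"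
  shows "x + y \<in> rational_polynomials"
proof -
  obtain P Q where PQ: "x = image_over_graded_ring wt a P" "\<And>m. Poly_Mapping.lookup P m \<in> L"
    "y = image_over_graded_ring wt a Q" "\<And>m. Poly_Mapping.lookup Q m \<in> L"
    using assms unfolding rational_polynomials_def by blast
  have "x + y = image_over_graded_ring wt a (P + Q)"
    by (simp add: PQ image_over_graded_ring_add)
  moreover have "Poly_Mapping.lookup (P + Q) m \<in> L" for m
    unfolding lookup_add by (intro L_add PQ)
  ultimately show ?thesis unfolding rational_polynomials_def by blast
qed

lemma rational_polynomials_sum:
  "(\<And>x. x \<in> A \<Longrightarrow> f x \<in> rational_polynomials) \<Longrightarrow> (\<Sum>x\<in>A. f x) \<in> rational_polynomials"
  by (induction A rule: infinite_finite_induct) (simp_all add: rational_polynomials_zero rational_polynomials_add)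

lemma rational_polynomials_monomial:
  assumes "x \<in> rational_component \<kappa>"
  shows "Poly_Mapping.single e x \<in> rational_polynomials"
proof -
  obtain f where f: "x = Poly_Mapping.single \<kappa> f" "f \<in> modular_forms \<kappa> \<Gamma>" "q_coeffs_in L f"
    using assms unfolding rational_component_def by blast
  obtain T c where T: "finite T" "\<And>u. u \<in> T \<Longrightarrow> exponent_weight wt u = \<kappa>" "\<And>u. c u \<in> L"
    and sum: "f = (\<Sum>u\<in>T. fun_scale (c u) (monomial_form a u))"
    using rational_form_combination[OF f(2,3)] by blast
  have "Poly_Mapping.single e x =
      (\<Sum>u\<in>T. Poly_Mapping.single e (Poly_Mapping.single \<kappa> (fun_scale (c u) (monomial_form a u))))"
    unfolding f(1) sum single_sum ..
  also have "\<dots> \<in> rational_polynomials"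
  proof (rule rational_polynomials_sum)
    fix u assume "u \<in> T"
    obtain m where m: "image_over_graded_ring wt a (Poly_Mapping.single m (c u)) =
        Poly_Mapping.single e (Poly_Mapping.single (exponent_weight wt u) (fun_scale (c u) (monomial_form a u)))"
      using image_over_graded_ring_monomial by blast
    have "Poly_Mapping.lookup (Poly_Mapping.single m (c u)) m' \<in> L" for m'
      using T(3) by (simp add: lookup_single when_def)
    thus "Poly_Mapping.single e (Poly_Mapping.single \<kappa> (fun_scale (c u) (monomial_form a u))) \<in> rational_polynomials"
      unfolding T(2)[OF \<open>u \<in> T\<close>, symmetric] m[symmetric] rational_polynomials_def by blast
  qed
  finally show ?thesis .
qed

lemma rational_series_polynomial:
  assumes F: "rational_series F" "finite_support F"
  shows "\<exists>P. (\<forall>m. Poly_Mapping.lookup P m \<in> L) \<and> Poly_Mapping.lookup (image_over_graded_ring wt a P) = F"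
proof -
  let ?S = "{e. F e \<noteq> 0}"
  have "(\<Sum>e\<in>?S. Poly_Mapping.single e (F e)) \<in> rational_polynomials"
    using F(1) unfolding rational_series_def
    by (blast intro: rational_polynomials_sum rational_polynomials_monomial)
  then obtain P where P: "\<forall>m. Poly_Mapping.lookup P m \<in> L"
    "(\<Sum>e\<in>?S. Poly_Mapping.single e (F e)) = image_over_graded_ring wt a P"
    unfolding rational_polynomials_def by blast
  have "Poly_Mapping.lookup (\<Sum>e\<in>?S. Poly_Mapping.single e (F e)) = F"
  proof
    fix e
    have "Poly_Mapping.lookup (\<Sum>e\<in>?S. Poly_Mapping.single e (F e)) e = (\<Sum>k\<in>?S. if k = e then F k else 0)"
      unfolding lookup_sum by (intro sum.cong) (auto simp: lookup_single when_def)
    also have "\<dots> = F e" using F(2) by (simp add: finite_support_def)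
    finally show "Poly_Mapping.lookup (\<Sum>e\<in>?S. Poly_Mapping.single e (F e)) e = F e" .
  qed
  thus ?thesis using P by metis
qed

lemma rational_quotient:
  assumes "rational_series F" "rational_series Q" "finite_support Q" "Q 0 = 1"
    and "finite_support (mpseries_mult Q F)"
  shows "(\<forall>e. F e \<in> graded_ring \<Gamma>) \<and>
    (\<exists>P Q. (\<forall>m. Poly_Mapping.lookup P m \<in> L) \<and> (\<forall>m. Poly_Mapping.lookup Q m \<in> L) \<and>
      image_over_graded_ring wt a Q \<noteq> 0 \<and>
      mpseries_mult (Poly_Mapping.lookup (image_over_graded_ring wt a Q)) F =
        Poly_Mapping.lookup (image_over_graded_ring wt a P))"
proof -
  obtain Q' where Q': "\<forall>m. Poly_Mapping.lookup Q' m \<in> L" "Poly_Mapping.lookup (image_over_graded_ring wt a Q') = Q"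
    using rational_series_polynomial[OF assms(2,3)] by blast
  obtain P where P: "\<forall>m. Poly_Mapping.lookup P m \<in> L"
    "Poly_Mapping.lookup (image_over_graded_ring wt a P) = mpseries_mult Q F"
    using rational_series_polynomial[OF rational_series_mult[OF assms(2,1)] assms(5)] by blast
  have "(1 :: graded_form) \<noteq> 0"
  proof
    assume "(1 :: graded_form) = 0"
    hence "Poly_Mapping.lookup (1 :: graded_form) 0 = Poly_Mapping.lookup 0 0" by simp
    hence "(1 :: upper_half_plane \<Rightarrow> complex) = 0" by simp
    thus False by (simp add: fun_eq_iff)
  qed
  hence "image_over_graded_ring wt a Q' \<noteq> 0"
    using Q'(2) assms(4) by auto
  moreover have "F e \<in> graded_ring \<Gamma>" for e
    using assms(1) rational_component_subset_graded_ring unfolding rational_series_def by blast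
  ultimately show ?thesis using P Q' by metis
qed

end


section \<open>Rationality of the generating function\<close>

lemma prime_form_slash_eq:
  "slash \<kappa> (prime_form C \<alpha> \<kappa> f) M = fun_scale (C ^ \<kappa>) (slash \<kappa> (slash \<kappa> f \<alpha>) M)"
  unfolding prime_form_def slash_scale ..

lemma slash_monomial_form:
  "slash (exponent_weight wt e) (monomial_form a e) M = monomial_form (\<lambda>i. slash (wt i) (a i) M) e"
  unfolding exponent_weight_def monomial_form_def slash_prod slash_power ..

lemma scale_monomial_form:
  "fun_scale (C ^ exponent_weight wt e) (monomial_form a e) = monomial_form (\<lambda>i. fun_scale (C ^ wt i) (a i)) e"
proof
  fix \<tau>
  have "C ^ exponent_weight wt e = (\<Prod>i\<in>UNIV. (C ^ wt i) ^ Poly_Mapping.lookup e i)"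
    unfolding exponent_weight_def power_sum by (intro prod.cong refl) (simp add: power_mult [symmetric] mult.commute)
  thus "fun_scale (C ^ exponent_weight wt e) (monomial_form a e) \<tau> = monomial_form (\<lambda>i. fun_scale (C ^ wt i) (a i)) e \<tau>"
    by (simp add: fun_scale_def monomial_form_def fun_prod_apply fun_power_apply power_mult_distrib prod.distrib)
qed

lemma monomial_form_add_single:
  "monomial_form x (e + Poly_Mapping.single i t) = monomial_form x e * x i ^ t"
proof -
  have "(\<Prod>j\<in>UNIV. x j ^ Poly_Mapping.lookup (Poly_Mapping.single i t) j) = (\<Prod>j\<in>UNIV. if i = j then x j ^ t else 1)"
    by (intro prod.cong) (auto simp: lookup_single when_def)
  also have "\<dots> = x i ^ t" by simp
  finally have "(\<Prod>j\<in>UNIV. x j ^ Poly_Mapping.lookup (Poly_Mapping.single i t) j) = x i ^ t" .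
  thus ?thesis
    unfolding monomial_form_def lookup_add power_add prod.distrib by (simp only:)
qed

context rational_hecke
begin

lemma conjugate_monomial_form:
  "conjugate_form (exponent_weight wt e) (monomial_form a e) K =
    monomial_form (\<lambda>i. conjugate_form (wt i) (a i) K) e"
  unfolding conjugate_form_def prime_form_slash_eq slash_monomial_form scale_monomial_form ..

definition generator_conjugates :: "'r \<Rightarrow> (upper_half_plane \<Rightarrow> complex) set"
  where "generator_conjugates i = conjugates (wt i) (a i)"

text \<open>
  The polynomial \<open>\<Prod>\<^sub>g (1 - A\<^sub>i g)\<close>, where \<open>g\<close> runs over the conjugates of \<open>a\<^sub>i'\<close>: the reversed
  characteristic polynomial.
\<close>

definition euler_factor :: "'r \<Rightarrow> ('r, graded_form) mpseries"
  where "euler_factor i e =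
    (if e \<in> Poly_Mapping.single i ` {..card (generator_conjugates i)}
     then Poly_Mapping.single (exponent_weight wt e)
       (coeff (char_poly (generator_conjugates i)) (card (generator_conjugates i) - Poly_Mapping.lookup e i))
     else 0)"

lemma euler_factor_single:
  assumes "j \<le> card (generator_conjugates i)"
  shows "euler_factor i (Poly_Mapping.single i j) = Poly_Mapping.single (j * wt i)
    (coeff (char_poly (generator_conjugates i)) (card (generator_conjugates i) - j))"
  using assms by (simp add: euler_factor_def exponent_weight_single)

lemma generator_char_poly_homogeneous_monic:
  "homogeneous_monic (wt i) (card (generator_conjugates i)) (char_poly (generator_conjugates i))"
  unfolding generator_conjugates_def
  by (rule homogeneous_monic_char_poly[OF finite_conjugates conjugates_modular[OF generator_modular]])

lemma rational_series_euler_factor: "rational_series (euler_factor i)"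
  unfolding rational_series_def
proof
  fix e
  let ?n = "card (generator_conjugates i)"
  show "euler_factor i e \<in> rational_component (exponent_weight wt e)"
  proof (cases "e \<in> Poly_Mapping.single i ` {..?n}")
    case True
    then obtain j where j: "j \<le> ?n" "e = Poly_Mapping.single i j" by blast
    have "coeff (char_poly (generator_conjugates i)) (?n - j) \<in> modular_forms ((?n - (?n - j)) * wt i) \<Gamma>"
      unfolding generator_conjugates_def by (rule char_poly_conjugates_modular[OF generator_modular]) simp
    moreover have "q_coeffs_in L (coeff (char_poly (generator_conjugates i)) (?n - j))"
      unfolding generator_conjugates_def
      by (rule char_poly_conjugates_rational[OF generator_modular generator_rational]) simp
    ultimately show ?thesis
      unfolding j(2) euler_factor_single[OF j(1)] exponent_weight_single diff_diff_cancel[OF j(1)]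
      by (rule rational_componentI)
  next
    case False
    thus ?thesis by (simp add: euler_factor_def rational_component_zero)
  qed
qed

lemma finite_support_euler_factor: "finite_support (euler_factor i)"
  unfolding finite_support_def
  by (rule finite_subset[of _ "Poly_Mapping.single i ` {..card (generator_conjugates i)}"])
     (auto simp: euler_factor_def)

lemma euler_factor_zero_exponent: "euler_factor i 0 = 1"
proof -
  have "coeff (char_poly (generator_conjugates i)) (card (generator_conjugates i)) = 1"
    using generator_char_poly_homogeneous_monic by (simp add: homogeneous_monic_def)
  thus ?thesis using euler_factor_single[of 0 i] by simp
qed

definition hecke_series :: "complex \<Rightarrow> ('r \<Rightarrow>\<^sub>0 nat) set \<Rightarrow> ('r, graded_form) mpseries"
  where "hecke_series c B e =
    (if e \<in> B then Poly_Mapping.single (exponent_weight wt e) (hecke \<Gamma> \<alpha> C c (exponent_weight wt e) (monomial_form a e))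
     else 0)"

lemma rational_series_hecke:
  assumes "c \<in> L"
  shows "rational_series (hecke_series c B)"
  using assms
  by (auto simp: rational_series_def hecke_series_def rational_component_zero
      intro!: rational_componentI hecke_modular hecke_rational monomial_modular monomial_rational)

lemma hecke_monomial_add_single:
  "hecke \<Gamma> \<alpha> C c (exponent_weight wt (e + Poly_Mapping.single i t)) (monomial_form a (e + Poly_Mapping.single i t)) \<tau> =
    c * (\<Sum>K\<in>cosets. monomial_form (\<lambda>i. conjugate_form (wt i) (a i) K) e \<tau> * conjugate_form (wt i) (a i) K \<tau> ^ t)"
  unfolding hecke_eq conjugate_monomial_form unfolding monomial_form_add_single
  by (simp add: fun_scale_def fun_sum_apply fun_power_apply)

text \<open>
  Along the direction of \<open>A\<^sub>i\<close> the coefficients of the generating function are eventually a linear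
  combination of geometric progressions whose ratios are the conjugates of \<open>a\<^sub>i'\<close>, and the Euler
  factor is their common recurrence.
\<close>

lemma hecke_recurrence:
  defines "n \<equiv> \<lambda>i. card (generator_conjugates i)"
  shows "(\<Sum>t\<le>n i. coeff (char_poly (generator_conjugates i)) t *
    hecke \<Gamma> \<alpha> C c (exponent_weight wt (e + Poly_Mapping.single i t)) (monomial_form a (e + Poly_Mapping.single i t))) = 0"
    (is "(\<Sum>t\<le>n i. ?m t * ?h t) = 0")
proof
  fix \<tau>
  define u where "u = (\<lambda>K. monomial_form (\<lambda>i. conjugate_form (wt i) (a i) K) e \<tau>)"
  define x where "x = (\<lambda>K. conjugate_form (wt i) (a i) K)"
  have root: "(\<Sum>t\<le>n i. ?m t \<tau> * x K \<tau> ^ t) = 0" if "K \<in> cosets" for K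
  proof -
    have "x K \<in> generator_conjugates i"
      using that by (simp add: x_def generator_conjugates_def conjugates_def)
    moreover have "finite (generator_conjugates i)"
      by (simp add: generator_conjugates_def finite_conjugates)
    ultimately have "poly (char_poly (generator_conjugates i)) (x K) = 0"
      by (intro char_poly_root)
    hence "(\<Sum>t\<le>n i. ?m t * x K ^ t) \<tau> = 0"
      unfolding homogeneous_monic_eval[OF generator_char_poly_homogeneous_monic] n_def by simp
    thus ?thesis by (simp add: fun_sum_apply fun_power_apply)
  qed
  have "(\<Sum>t\<le>n i. ?m t * ?h t) \<tau> = (\<Sum>t\<le>n i. ?m t \<tau> * ?h t \<tau>)"
    by (simp add: fun_sum_apply)
  also have "\<dots> = (\<Sum>t\<le>n i. \<Sum>K\<in>cosets. c * u K * (?m t \<tau> * x K \<tau> ^ t))"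
    unfolding hecke_monomial_add_single u_def x_def sum_distrib_left
    by (intro sum.cong refl) (simp only: mult_ac)
  also have "\<dots> = (\<Sum>K\<in>cosets. \<Sum>t\<le>n i. c * u K * (?m t \<tau> * x K \<tau> ^ t))"
    by (rule sum.swap)
  also have "\<dots> = (\<Sum>K\<in>cosets. c * u K * (\<Sum>t\<le>n i. ?m t \<tau> * x K \<tau> ^ t))"
    by (simp only: sum_distrib_left)
  also have "\<dots> = 0"
    by (rule sum.neutral) (simp add: root)
  finally show "(\<Sum>t\<le>n i. ?m t * ?h t) \<tau> = 0 \<tau>" by simp
qed

lemma euler_factor_mult:
  assumes e: "card (generator_conjugates i) \<le> Poly_Mapping.lookup e i"
  shows "mpseries_mult (euler_factor i) F e =
    (\<Sum>j\<le>card (generator_conjugates i). euler_factor i (Poly_Mapping.single i j) * F (e - Poly_Mapping.single i j))"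
proof -
  let ?n = "card (generator_conjugates i)"
  define f where "f = (\<lambda>j. (Poly_Mapping.single i j, e - Poly_Mapping.single i j))"
  have split: "Poly_Mapping.single i j + (e - Poly_Mapping.single i j) = e" if "j \<le> ?n" for j
    by (rule exponent_le_imp_add) (use that e in \<open>auto simp: lookup_single when_def\<close>)
  have "mpseries_mult (euler_factor i) F e = (\<Sum>(k, l)\<in>f ` {..?n}. euler_factor i k * F l)"
    unfolding mpseries_mult_def
  proof (rule sum.mono_neutral_right)
    show "f ` {..?n} \<subseteq> {(k, l). k + l = e}" using split by (auto simp: f_def)
    show "\<forall>p\<in>{(k, l). k + l = e} - f ` {..?n}. (case p of (k, l) \<Rightarrow> euler_factor i k * F l) = 0"
    proof
      fix p assume p: "p \<in> {(k, l). k + l = e} - f ` {..?n}"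
      obtain k l where kl: "p = (k, l)" by (cases p)
      have "k \<notin> Poly_Mapping.single i ` {..?n}"
      proof
        assume "k \<in> Poly_Mapping.single i ` {..?n}"
        then obtain j where j: "j \<le> ?n" "k = Poly_Mapping.single i j" by blast
        have "e = k + l" using p kl by simp
        hence "l = e - Poly_Mapping.single i j" unfolding j(2) by simp
        hence "p = f j" unfolding f_def kl j(2) by simp
        thus False using p j(1) by blast
      qed
      thus "(case p of (k, l) \<Rightarrow> euler_factor i k * F l) = 0" by (simp add: kl euler_factor_def)
    qed
  qed (rule finite_decompositions)
  also have "\<dots> = (\<Sum>j\<le>?n. case f j of (k, l) \<Rightarrow> euler_factor i k * F l)"
  proof (rule sum.reindex_cong[OF _ refl refl])
    show "inj_on f {..?n}"
      by (rule inj_onI) (metis Pair_inject f_def lookup_single_eq)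
  qed
  finally show ?thesis by (simp add: f_def)
qed

lemma vanishes_beyond_euler_factor:
  assumes stable: "\<And>e t. D \<le> Poly_Mapping.lookup e i \<Longrightarrow> e + Poly_Mapping.single i t \<in> B \<longleftrightarrow> e \<in> B"
  shows "vanishes_beyond i (mpseries_mult (euler_factor i) (hecke_series c B))"
proof -
  define n where "n = card (generator_conjugates i)"
  have "mpseries_mult (euler_factor i) (hecke_series c B) e = 0" if e: "n + D \<le> Poly_Mapping.lookup e i" for e
  proof -
    \<comment> \<open>All exponents that contribute are \<open>e\<^sub>0\<close> plus at most \<open>n\<close> steps, in the stable range.\<close>
    define e\<^sub>0 where "e\<^sub>0 = e - Poly_Mapping.single i n"
    have D: "D \<le> Poly_Mapping.lookup e\<^sub>0 i" using e by (simp add: e\<^sub>0_def lookup_minus)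
    have shift: "e - Poly_Mapping.single i j = e\<^sub>0 + Poly_Mapping.single i (n - j)" if "j \<le> n" for j
    proof (rule poly_mapping_eqI)
      fix k
      show "Poly_Mapping.lookup (e - Poly_Mapping.single i j) k = Poly_Mapping.lookup (e\<^sub>0 + Poly_Mapping.single i (n - j)) k"
        using that e by (auto simp: e\<^sub>0_def lookup_add lookup_minus lookup_single when_def)
    qed
    let ?W = "exponent_weight wt e\<^sub>0 + n * wt i"
    let ?m = "coeff (char_poly (generator_conjugates i))"
    let ?h = "\<lambda>t. hecke \<Gamma> \<alpha> C c (exponent_weight wt (e\<^sub>0 + Poly_Mapping.single i t)) (monomial_form a (e\<^sub>0 + Poly_Mapping.single i t))"
    have "card (generator_conjugates i) \<le> Poly_Mapping.lookup e i" using e by (simp add: n_def)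
    note mult = euler_factor_mult[OF this, of "hecke_series c B", folded n_def]
    show ?thesis
    proof (cases "e\<^sub>0 \<in> B")
      case False
      have "hecke_series c B (e - Poly_Mapping.single i j) = 0" if "j \<le> n" for j
        using False stable[OF D] by (simp add: shift[OF that] hecke_series_def)
      thus ?thesis unfolding mult by (intro sum.neutral) simp
    next
      case True
      have term_eq: "euler_factor i (Poly_Mapping.single i j) * hecke_series c B (e - Poly_Mapping.single i j) =
          Poly_Mapping.single ?W (?m (n - j) * ?h (n - j))" if "j \<le> n" for j
      proof -
        have "hecke_series c B (e - Poly_Mapping.single i j) =
            Poly_Mapping.single (exponent_weight wt (e\<^sub>0 + Poly_Mapping.single i (n - j))) (?h (n - j))"
          using True stable[OF D] by (simp add: shift[OF that] hecke_series_def)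
        moreover have "j * wt i + exponent_weight wt (e\<^sub>0 + Poly_Mapping.single i (n - j)) = ?W"
        proof -
          have "j * wt i + (n - j) * wt i = n * wt i" using that by (simp flip: distrib_right)
          thus ?thesis unfolding exponent_weight_add exponent_weight_single by simp
        qed
        ultimately show ?thesis
          using that euler_factor_single[of j i] by (simp only: n_def mult_single)
      qed
      have "mpseries_mult (euler_factor i) (hecke_series c B) e =
          (\<Sum>j\<le>n. Poly_Mapping.single ?W (?m (n - j) * ?h (n - j)))"
        unfolding mult by (intro sum.cong refl term_eq) simp
      also have "\<dots> = (\<Sum>t\<le>n. Poly_Mapping.single ?W (?m t * ?h t))"
        by (rule sum.reindex_bij_witness[of _ "\<lambda>t. n - t" "\<lambda>t. n - t"]) simp_all
      also have "\<dots> = Poly_Mapping.single ?W (\<Sum>t\<le>n. ?m t * ?h t)"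
        by (rule single_sum [symmetric])
      also have "\<dots> = 0"
        unfolding n_def hecke_recurrence by (rule single_zero)
      finally show ?thesis .
    qed
  qed
  thus ?thesis unfolding vanishes_beyond_def by blast
qed

text \<open>
  The Euler factor of \<open>A\<^sub>i\<close> makes the series finite in the direction of \<open>A\<^sub>i\<close>. Multiplication by the
  other Euler factors, which are polynomials, does not destroy this, so their product makes the series
  finite in all directions.
\<close>

lemma ex_denominator:
  fixes B :: "('r \<Rightarrow>\<^sub>0 nat) set"
  assumes stable: "\<And>i. \<exists>D. \<forall>e. D \<le> Poly_Mapping.lookup e i \<longrightarrow> (\<forall>t. e + Poly_Mapping.single i t \<in> B \<longleftrightarrow> e \<in> B)"
  shows "\<exists>Q. rational_series Q \<and> finite_support Q \<and> Q 0 = 1 \<and> finite_support (mpseries_mult Q (hecke_series c B))"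
proof -
  let ?F = "hecke_series c B"
  have "\<exists>Q. rational_series Q \<and> finite_support Q \<and> Q 0 = 1 \<and> (\<forall>i\<in>S. vanishes_beyond i (mpseries_mult Q ?F))"
    if "finite S" for S :: "'r set"
    using that
  proof (induction S)
    case empty
    show ?case
      by (intro exI[of _ unit_series] conjI rational_series_unit finite_support_unit)
        (simp_all add: unit_series_def)
  next
    case (insert i S)
    then obtain Q where Q: "rational_series Q" "finite_support Q" "Q 0 = 1"
      "\<And>j. j \<in> S \<Longrightarrow> vanishes_beyond j (mpseries_mult Q ?F)" by blast
    let ?Q = "mpseries_mult (euler_factor i) Q"
    have "vanishes_beyond i (mpseries_mult ?Q ?F)"
    proof -
      obtain D where "\<And>e t. D \<le> Poly_Mapping.lookup e i \<Longrightarrow> e + Poly_Mapping.single i t \<in> B \<longleftrightarrow> e \<in> B"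
        using stable[of i] by blast
      hence "vanishes_beyond i (mpseries_mult (euler_factor i) ?F)"
        by (rule vanishes_beyond_euler_factor)
      hence "vanishes_beyond i (mpseries_mult Q (mpseries_mult (euler_factor i) ?F))"
        by (rule vanishes_beyond_mult[OF Q(2)])
      thus ?thesis
        unfolding mpseries_mult_assoc [symmetric] mpseries_mult_commute[of Q "euler_factor i"] .
    qed
    moreover have "vanishes_beyond j (mpseries_mult ?Q ?F)" if "j \<in> S" for j
      unfolding mpseries_mult_assoc by (rule vanishes_beyond_mult[OF finite_support_euler_factor Q(4)[OF that]])
    ultimately have "\<forall>j\<in>insert i S. vanishes_beyond j (mpseries_mult ?Q ?F)" by blast
    moreover have "?Q 0 = 1"
      by (simp add: mpseries_mult_zero_exponent euler_factor_zero_exponent Q(3))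
    ultimately show ?case
      using rational_series_mult[OF rational_series_euler_factor Q(1)]
        finite_support_mult[OF finite_support_euler_factor Q(2)] by blast
  qed
  from this[of UNIV] show ?thesis
    using vanishes_beyond_imp_finite_support by (metis UNIV_I finite)
qed

end

theorem theorem6p3:
  fixes \<Gamma> :: "mat2 set" and \<alpha> :: mat2 and L :: "complex set" and C c\<^sub>0 :: complex
    and ord :: "('r::finite \<Rightarrow>\<^sub>0 nat) rel"
    and wt :: "'r \<Rightarrow> nat" and a :: "'r \<Rightarrow> upper_half_plane \<Rightarrow> complex"
  assumes "congruence_subgroup \<Gamma>"
    and "det \<alpha> > 0"
    and "C \<noteq> 0"
    and "subfield_of_complex L"
    and "c\<^sub>0 \<in> L"
    and "\<And>\<kappa>. has_basis_over L (modular_forms \<kappa> \<Gamma>)"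
    and "\<And>\<kappa>. has_basis_over L (modular_forms \<kappa> (hecke_subgroup \<Gamma> \<alpha>))"
    and "\<And>\<kappa> f. f \<in> modular_forms \<kappa> \<Gamma> \<Longrightarrow> q_coeffs_in L f \<Longrightarrow> q_coeffs_in L (prime_form C \<alpha> \<kappa> f)"
    and "\<And>i. a i \<in> modular_forms (wt i) \<Gamma>"
    and "\<And>i. q_coeffs_in L (a i)"
    and "range (mpoly_eval graded_const (\<lambda>i. Poly_Mapping.single (wt i) (a i))) = graded_ring \<Gamma>"
    and "term_order ord"
  shows "(\<forall>e. hecke_generating_function \<Gamma> \<alpha> C c\<^sub>0 ord wt a e \<in> graded_ring \<Gamma>) \<and>
    (\<exists>P Q :: ('r + 'r, complex) mpoly.
      (\<forall>m. Poly_Mapping.lookup P m \<in> L) \<and> (\<forall>m. Poly_Mapping.lookup Q m \<in> L) \<and>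
      image_over_graded_ring wt a Q \<noteq> 0 \<and>
      mpseries_mult (Poly_Mapping.lookup (image_over_graded_ring wt a Q))
        (hecke_generating_function \<Gamma> \<alpha> C c\<^sub>0 ord wt a)
      = Poly_Mapping.lookup (image_over_graded_ring wt a P))"
proof -
  obtain \<rho> where "coefficient_retraction L \<rho>"
    using ex_coefficient_retraction[OF \<open>subfield_of_complex L\<close>] by blast
  then interpret coefficient_retraction L \<rho> .
  interpret rational_generators L \<rho> \<Gamma> wt a
    by unfold_locales fact+
  let ?F = "hecke_generating_function \<Gamma> \<alpha> C c\<^sub>0 ord wt a"
  have "\<exists>Q. rational_series ?F \<and> rational_series Q \<and> finite_support Q \<and> Q 0 = 1 \<and>
    finite_support (mpseries_mult Q ?F)"
  proof (cases "finite (right_cosets (hecke_subgroup \<Gamma> \<alpha>) \<Gamma>)")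
    case True
    interpret rational_hecke L \<rho> \<Gamma> wt a \<alpha> C
      by unfold_locales fact+
    have F: "?F = hecke_series c\<^sub>0 (standard_exponents ord (relation_ideal wt a))"
      by (rule ext) (simp add: hecke_generating_function_def hecke_series_def Let_def
          exponent_weight_def monomial_form_def)
    show ?thesis
      unfolding F using rational_series_hecke[OF \<open>c\<^sub>0 \<in> L\<close>] ex_denominator[OF standard_exponents_stabilize]
      by blast
  next
    case False
    hence hecke: "hecke \<Gamma> \<alpha> C c\<^sub>0 \<kappa> f = 0" for \<kappa> f
      by (simp add: hecke_def fun_scale_def fun_eq_iff)
    have F: "?F e = 0" for e
      by (simp add: hecke_generating_function_def Let_def hecke)
    have "rational_series ?F" by (simp add: rational_series_def F rational_component_zero)
    moreover have "finite_support (mpseries_mult unit_series ?F)"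
      unfolding mpseries_mult_unit by (simp add: finite_support_def F)
    moreover have "unit_series (0 :: 'r \<Rightarrow>\<^sub>0 nat) = (1 :: graded_form)"
      by (simp add: unit_series_def)
    ultimately show ?thesis
      using rational_series_unit finite_support_unit by blast
  qed
  then obtain Q where "rational_series ?F" "rational_series Q" "finite_support Q" "Q 0 = 1"
    "finite_support (mpseries_mult Q ?F)" by blast
  thus ?thesis by (rule rational_quotient)
qed

end
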